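(* Let $X_1,X_2,\dots$ be i.i.d. with $\mathbf{E}X_1=-a<0$ and $\mathrm{Var}(X_1)<\infty$. Assume $\overline F(x)\sim e^{-g(x)}x^{-2}$ as $x\to\infty$, where $g:(0,\infty)\to\mathbb{R}$ is continuously differentiable, nondecreasing for all sufficiently large $x$, such that for some $\gamma_0\in(0,1/2)$ the function $x\mapsto g(x)/x^{\gamma_0}$ is nonincreasing on $(0,\infty)$ with $g(x)/x^{\gamma_0}\to0$, and such that $xg'(x)\to\infty$ as $x\to\infty$. Then \[ \mathbf{P}(A_\tau>x)\sim\mathbf{E}\tau\,\overline F(\sqrt{2ax}),\qquad x\to\infty. \]
   Context: $S_0=0$, $S_n=X_1+\dots+X_n$, $\overline F(x)=\mathbf{P}(X_1>x)$, $\tau=\min\{n\ge1:S_n\le0\}$, $A_\tau=\sum_{k=0}^{\tau-1}S_k$. *)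

theory Defs
  imports "HOL-Probability.Probability" "HOL-Library.Landau_Symbols"
begin

text \<open>Random walk notions. The increments X_1, X_2, ... are represented as X 0, X 1, ...\<close>

definition rw_S :: "(nat \<Rightarrow> 'a \<Rightarrow> real) \<Rightarrow> nat \<Rightarrow> 'a \<Rightarrow> real" where
  "rw_S X n \<omega> = (\<Sum>k<n. X k \<omega>)"

definition rw_tau :: "(nat \<Rightarrow> 'a \<Rightarrow> real) \<Rightarrow> 'a \<Rightarrow> nat" where
  "rw_tau X \<omega> = (LEAST n. n \<ge> 1 \<and> rw_S X n \<omega> \<le> 0)"

definition rw_area :: "(nat \<Rightarrow> 'a \<Rightarrow> real) \<Rightarrow> 'a \<Rightarrow> real" where
  "rw_area X \<omega> = (\<Sum>k<rw_tau X \<omega>. rw_S X k \<omega>)"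

end

theory Submission
  imports Defs
begin

text \<open>
  One big jump. Put \<open>y = sqrt (2 a x)\<close>, so that a jump to height \<open>y\<close> followed by a descent of slope
  \<open>-a\<close> has area \<open>x\<close>. For \<open>\<theta> = g z / z\<close> the increments truncated at \<open>z\<close> satisfy
  \<open>E exp (\<theta> min (X, z)) \<le> exp (- a \<theta> + O (\<theta>\<^sup>2))\<close>, because \<open>g x / x powr \<gamma>\<close> is nonincreasing. Since \<open>\<gamma> < 1/2\<close>,
  \<open>\<theta>\<close> is small compared with \<open>\<delta> = y powr (-\<gamma>)\<close>, so the maximum of the truncated walk with drift
  \<open>a - \<delta>\<close> added has exponential tail with rate \<open>\<theta>\<close>; and a walk below the line \<open>H - (a - \<delta>) j\<close> has area at most
  about \<open>H\<^sup>2 / (2 (a - \<delta>))\<close>. Truncate at \<open>z = y / 2\<close> and let time run up to \<open>y\<^sup>2\<close>. Excursions without a jump above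
  \<open>y / 2\<close>, with two of them, or longer than \<open>y\<^sup>2\<close> are negligible: the first two have probability at most
  \<open>exp (- (1 + c) g y)\<close> for some \<open>c > 0\<close>. With one such jump \<open>X k\<close>, the maximum \<open>U\<close> of the walk that omits
  this jump must satisfy \<open>X k + U > y - O (y powr (1 - \<gamma>))\<close>. On the scale \<open>y / g y\<close>, on which the tail of
  \<open>X k\<close> varies, \<open>U\<close> is negligible, and summing over \<open>k\<close> the probability that the excursion is still alive
  gives the factor \<open>E \<tau>\<close>. The lower bound follows from the fluctuations being \<open>o (y / g y)\<close> after the jump.
\<close>

text \<open>The delicate case is a single large jump that misses \<open>y\<close> by
  \<open>v\<close>, with the rest of the walk supplying the missing height. Put
  \<open>r = g y / y\<close>. Since \<open>\<gamma> < 1/2\<close>, the tail at \<open>y - v\<close>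
  is at most a constant times \<open>G y * exp (3/5 * r * v)\<close>; 3/5 lies just above
  \<open>2 - sqrt 2\<close>, the slope lost by the chord of the square root on [1/2, 1]. Truncation
  at \<open>y / 2\<close> gives the remaining walk an exponential tail of rate
  \<open>7/5 * r\<close>. The obstacle is that survival up to the jump and the maximum of the
  remaining walk share increments. Bounding their joint probability by a geometric mean halves the
  rate to \<open>7/10 * r\<close>, which still beats 3/5. The price is a weight
  \<open>sqrt (survival k)\<close>; it is summable because \<open>x * g' x\<close> tending to
  infinity makes \<open>g\<close> outgrow every multiple of \<open>ln\<close>. The same growth puts
  a surplus factor \<open>exp (- c * g y)\<close> below the \<open>y powr (-2)\<close> contained in
  \<open>G y\<close>. Besides fitting the rate under the drift slack, \<open>\<gamma> < 1/2\<close>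
  makes \<open>(g y)^2 / y\<close> tend to zero, so that square root fluctuations over a time
  \<open>y / a\<close> stay below the scale \<open>y / g y\<close>.\<close>

context prob_space
begin

section \<open>Independence over disjoint blocks and an exponential maximal inequality\<close>

lemma indep_var_of_disjoint_coords:
  fixes X :: "'i \<Rightarrow> 'a \<Rightarrow> real" and \<phi> \<psi> :: "('i \<Rightarrow> real) \<Rightarrow> real"
  assumes X: "indep_vars (\<lambda>_. borel) X UNIV" and AB: "A \<inter> B = {}"
    and \<phi>: "\<phi> \<in> borel_measurable (PiM UNIV (\<lambda>_. borel))"
    and \<psi>: "\<psi> \<in> borel_measurable (PiM UNIV (\<lambda>_. borel))"
    and \<phi>A: "\<And>f h. (\<And>i. i \<in> A \<Longrightarrow> f i = h i) \<Longrightarrow> \<phi> f = \<phi> h"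
    and \<psi>B: "\<And>f h. (\<And>i. i \<in> B \<Longrightarrow> f i = h i) \<Longrightarrow> \<psi> f = \<psi> h"
  shows "indep_var borel (\<lambda>\<omega>. \<phi> (\<lambda>i. X i \<omega>)) borel (\<lambda>\<omega>. \<psi> (\<lambda>i. X i \<omega>))"
proof -
  \<comment> \<open>Extension by zero outside \<open>C\<close>: a functional that sees only the
    coordinates in \<open>C\<close> has the same value on a sequence and on the extension of its
    restriction, so independence of the restrictions carries over.\<close>
  define e :: "'i set \<Rightarrow> ('i \<Rightarrow> real) \<Rightarrow> 'i \<Rightarrow> real" where "e C f i = (if i \<in> C then f i else 0)" for C f i
  have e: "e C \<in> measurable (PiM C (\<lambda>_. borel)) (PiM UNIV (\<lambda>_. borel))" for C
    proof (rule measurable_PiM_single')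
    fix i show "(\<lambda>f. e C f i) \<in> borel_measurable (PiM C (\<lambda>_. borel))"
      by (cases "i \<in> C") (simp_all add: e_def)
  qed auto
  have "indep_var borel ((\<phi> \<circ> e A) \<circ> (\<lambda>\<omega>. restrict (\<lambda>i. X i \<omega>) A))
          borel ((\<psi> \<circ> e B) \<circ> (\<lambda>\<omega>. restrict (\<lambda>i. X i \<omega>) B))"
    by (intro indep_var_compose[OF indep_var_restrict[OF X AB]] measurable_comp[OF e] \<phi> \<psi>) auto
  moreover have "(\<phi> \<circ> e A) \<circ> (\<lambda>\<omega>. restrict (\<lambda>i. X i \<omega>) A) = (\<lambda>\<omega>. \<phi> (\<lambda>i. X i \<omega>))"
    by (auto simp: fun_eq_iff e_def intro!: \<phi>A)
  moreover have "(\<psi> \<circ> e B) \<circ> (\<lambda>\<omega>. restrict (\<lambda>i. X i \<omega>) B) = (\<lambda>\<omega>. \<psi> (\<lambda>i. X i \<omega>))"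
    by (auto simp: fun_eq_iff e_def intro!: \<psi>B)
  ultimately show ?thesis by simp
qed

lemma prob_disjoint_coords:
  fixes X :: "'i \<Rightarrow> 'a \<Rightarrow> real" and P Q :: "('i \<Rightarrow> real) \<Rightarrow> bool"
  assumes X: "indep_vars (\<lambda>_. borel) X UNIV" and AB: "A \<inter> B = {}"
    and [measurable]: "Measurable.pred (PiM UNIV (\<lambda>_. borel)) P"
    and [measurable]: "Measurable.pred (PiM UNIV (\<lambda>_. borel)) Q"
    and PA: "\<And>f h. (\<And>i. i \<in> A \<Longrightarrow> f i = h i) \<Longrightarrow> P f = P h"
    and QB: "\<And>f h. (\<And>i. i \<in> B \<Longrightarrow> f i = h i) \<Longrightarrow> Q f = Q h"
  shows "prob {\<omega> \<in> space M. P (\<lambda>i. X i \<omega>) \<and> Q (\<lambda>i. X i \<omega>)}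
       = prob {\<omega> \<in> space M. P (\<lambda>i. X i \<omega>)} * prob {\<omega> \<in> space M. Q (\<lambda>i. X i \<omega>)}"
proof -
  have "indep_var borel (\<lambda>\<omega>. of_bool (P (\<lambda>i. X i \<omega>)) :: real) borel (\<lambda>\<omega>. of_bool (Q (\<lambda>i. X i \<omega>)) :: real)"
  proof (rule indep_var_of_disjoint_coords[OF X AB, of "\<lambda>f. of_bool (P f)" "\<lambda>f. of_bool (Q f)"])
    fix f h :: "'i \<Rightarrow> real"
    show "(of_bool (P f) :: real) = of_bool (P h)" if "\<And>i. i \<in> A \<Longrightarrow> f i = h i"
      using PA[OF that] by simp
    show "(of_bool (Q f) :: real) = of_bool (Q h)" if "\<And>i. i \<in> B \<Longrightarrow> f i = h i"
      using QB[OF that] by simp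
  qed measurable
  from indep_varD[OF this, of "{1}" "{1}"] show ?thesis
    by (simp add: vimage_def Int_def conj_commute cong: conj_cong)
qed

text \<open>Stopping the exponential supermartingale at the first passage over \<open>u\<close>.\<close>

lemma exp_maximal_inequality:
  fixes X :: "nat \<Rightarrow> 'a \<Rightarrow> real" and f :: "real \<Rightarrow> real" and \<iota> :: "nat \<Rightarrow> nat"
  assumes X: "indep_vars (\<lambda>_. borel) X UNIV" and \<iota>: "inj \<iota>" and \<theta>: "0 \<le> \<theta>"
    and [measurable]: "f \<in> borel_measurable borel"
    and int: "\<And>i. integrable M (\<lambda>\<omega>. exp (\<theta> * f (X i \<omega>)))"
    and le1: "\<And>i. expectation (\<lambda>\<omega>. exp (\<theta> * f (X i \<omega>))) \<le> 1"
  shows "prob {\<omega> \<in> space M. \<exists>j\<le>n. u \<le> (\<Sum>i<j. f (X (\<iota> i) \<omega>))} \<le> exp (- \<theta> * u)"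
proof (cases "u \<le> 0")
  case True
  have "prob {\<omega> \<in> space M. \<exists>j\<le>n. u \<le> (\<Sum>i<j. f (X (\<iota> i) \<omega>))} \<le> 1" by simp
  also have "\<dots> \<le> exp (- \<theta> * u)" using True \<theta> by (simp add: mult_nonneg_nonpos)
  finally show ?thesis .
next
  case False
  have [measurable]: "X i \<in> borel_measurable M" for i
    using X by (auto simp: indep_vars_def)
  define T where "T j \<omega> = (\<Sum>i<j. f (X (\<iota> i) \<omega>))" for j \<omega>
  define H where "H n \<omega> \<longleftrightarrow> (\<exists>j\<le>n. u \<le> T j \<omega>)" for n \<omega>
  have [measurable]: "T j \<in> borel_measurable M" for j unfolding T_def by measurable
  have [measurable]: "Measurable.pred M (H n)" for n unfolding H_def by measurable
  \<comment> \<open>The exponential of the walk, killed once the level is reached. It depends on the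
    first \<open>n\<close> increments along \<open>\<iota>\<close>, and injectivity of
    \<open>\<iota>\<close> makes the next one independent of it.\<close>
  define R where "R n \<omega> = exp (\<theta> * T n \<omega>) * of_bool (\<not> H n \<omega>)" for n \<omega>
  have [measurable]: "R n \<in> borel_measurable M" for n unfolding R_def by measurable
  have H_Suc: "H (Suc n) \<omega> \<longleftrightarrow> H n \<omega> \<or> u \<le> T (Suc n) \<omega>" for n \<omega>
    unfolding H_def by (auto simp: le_Suc_eq)
  have T_Suc: "T (Suc n) \<omega> = T n \<omega> + f (X (\<iota> n) \<omega>)" for n \<omega>
    unfolding T_def by simp
  have ind: "indep_var borel (R n) borel (\<lambda>\<omega>. exp (\<theta> * f (X (\<iota> n) \<omega>)))" for n
  proof -
    define \<phi> :: "(nat \<Rightarrow> real) \<Rightarrow> real" where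
      "\<phi> h = exp (\<theta> * (\<Sum>i<n. f (h (\<iota> i)))) * of_bool (\<not> (\<exists>j\<le>n. u \<le> (\<Sum>i<j. f (h (\<iota> i)))))" for h
    have "indep_var borel (\<lambda>\<omega>. \<phi> (\<lambda>i. X i \<omega>)) borel (\<lambda>\<omega>. (\<lambda>h. exp (\<theta> * f (h (\<iota> n)))) (\<lambda>i. X i \<omega>))"
    proof (rule indep_var_of_disjoint_coords[OF X, where A="\<iota> ` {..<n}" and B="{\<iota> n}"])
      show "\<iota> ` {..<n} \<inter> {\<iota> n} = {}" using \<iota> by (auto simp: inj_def)
      show "\<phi> \<in> borel_measurable (PiM UNIV (\<lambda>_. borel))" unfolding \<phi>_def by measurable
      show "(\<lambda>h. exp (\<theta> * f (h (\<iota> n)))) \<in> borel_measurable (PiM UNIV (\<lambda>_. borel))" by measurable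
    next
      fix h h' :: "nat \<Rightarrow> real"
      assume *: "\<And>i. i \<in> \<iota> ` {..<n} \<Longrightarrow> h i = h' i"
      have "(\<Sum>i<j. f (h (\<iota> i))) = (\<Sum>i<j. f (h' (\<iota> i)))" if "j \<le> n" for j
        using that by (intro sum.cong) (auto simp: *)
      then show "\<phi> h = \<phi> h'" unfolding \<phi>_def by (auto simp: of_bool_def)
    qed auto
    then show ?thesis by (simp add: \<phi>_def R_def[abs_def] H_def T_def)
  qed
  \<comment> \<open>The balance kept by the induction: a path passing \<open>u\<close> for the first
    time leaves the killed expectation and enters the first term, where it is charged
    \<open>exp (\<theta> * u)\<close>, at most its current exponential. By \<open>le1\<close> the
    total does not grow.\<close>
  have *: "integrable M (R n) \<and> prob {\<omega> \<in> space M. H n \<omega>} * exp (\<theta> * u) + expectation (R n) \<le> 1" for n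
  proof (induction n)
    case 0
    have "\<not> H 0 \<omega>" for \<omega> using False by (simp add: H_def T_def)
    then show ?case by (simp add: R_def T_def prob_space)
  next
    case (Suc n)
    let ?Z = "\<lambda>\<omega>. R n \<omega> * exp (\<theta> * f (X (\<iota> n) \<omega>))"
    have Zint: "integrable M ?Z"
      using Suc int by (intro indep_var_integrable[OF ind]) auto
    have "expectation ?Z = expectation (R n) * expectation (\<lambda>\<omega>. exp (\<theta> * f (X (\<iota> n) \<omega>)))"
      using Suc int by (intro indep_var_lebesgue_integral[OF ind]) auto
    also have "\<dots> \<le> expectation (R n)"
      using le1[of "\<iota> n"] by (intro mult_left_le Bochner_Integration.integral_nonneg) (auto simp: R_def)
    finally have EZ: "expectation ?Z \<le> expectation (R n)" .
    have Z_eq: "?Z \<omega> = exp (\<theta> * T (Suc n) \<omega>) * of_bool (\<not> H n \<omega>)" for \<omega>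
      by (simp add: R_def T_Suc exp_add distrib_left)
    have Rint: "integrable M (R (Suc n))"
      by (rule Bochner_Integration.integrable_bound[OF Zint]) (auto simp: Z_eq[unfolded R_def] R_def H_Suc)
    let ?I = "indicator {\<omega> \<in> space M. \<not> H n \<omega> \<and> H (Suc n) \<omega>} :: 'a \<Rightarrow> real"
    have Iint: "integrable M ?I" by (rule integrable_real_indicator) (auto simp: less_top[symmetric])
    have "exp (\<theta> * u) * prob {\<omega> \<in> space M. \<not> H n \<omega> \<and> H (Suc n) \<omega>} + expectation (R (Suc n))
       = expectation (\<lambda>\<omega>. exp (\<theta> * u) * ?I \<omega> + R (Suc n) \<omega>)"
      using Rint Iint by (simp add: Int_def conj_commute conj_left_commute cong: conj_cong)
    also have "\<dots> \<le> expectation ?Z"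
    proof (rule integral_mono)
      show "integrable M (\<lambda>\<omega>. exp (\<theta> * u) * ?I \<omega> + R (Suc n) \<omega>)" using Rint Iint by simp
      show "exp (\<theta> * u) * ?I \<omega> + R (Suc n) \<omega> \<le> ?Z \<omega>" if "\<omega> \<in> space M" for \<omega>
        using that \<theta> unfolding Z_eq
        by (auto simp: R_def H_Suc indicator_def mult_left_mono)
    qed (rule Zint)
    finally have 1: "exp (\<theta> * u) * prob {\<omega> \<in> space M. \<not> H n \<omega> \<and> H (Suc n) \<omega>} + expectation (R (Suc n))
        \<le> expectation (R n)" using EZ by linarith
    have "prob {\<omega> \<in> space M. H (Suc n) \<omega>} \<le> prob ({\<omega> \<in> space M. H n \<omega>} \<union> {\<omega> \<in> space M. \<not> H n \<omega> \<and> H (Suc n) \<omega>})"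
      by (intro finite_measure_mono) auto
    also have "\<dots> \<le> prob {\<omega> \<in> space M. H n \<omega>} + prob {\<omega> \<in> space M. \<not> H n \<omega> \<and> H (Suc n) \<omega>}"
      by (intro measure_Un_le) auto
    finally have "prob {\<omega> \<in> space M. H (Suc n) \<omega>} * exp (\<theta> * u)
        \<le> (prob {\<omega> \<in> space M. H n \<omega>} + prob {\<omega> \<in> space M. \<not> H n \<omega> \<and> H (Suc n) \<omega>}) * exp (\<theta> * u)"
      by (intro mult_right_mono) auto
    then have "prob {\<omega> \<in> space M. H (Suc n) \<omega>} * exp (\<theta> * u) + expectation (R (Suc n)) \<le> 1"
      using 1 conjunct2[OF Suc] by (simp only: distrib_right mult.commute[of "exp (\<theta> * u)"])
    with Rint show ?case by blast
  qed
  have "0 \<le> expectation (R n)"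
    by (intro Bochner_Integration.integral_nonneg) (auto simp: R_def)
  with *[of n] have "prob {\<omega> \<in> space M. H n \<omega>} * exp (\<theta> * u) \<le> 1" by linarith
  then have "prob {\<omega> \<in> space M. H n \<omega>} \<le> exp (- \<theta> * u)"
    by (simp add: exp_minus field_simps)
  then show ?thesis by (simp add: H_def T_def)
qed

end

text \<open>Truncation acts only from above, so the bound must reach arbitrarily negative
  \<open>v\<close>. There, with \<open>s = - v\<close>, it amounts to
  \<open>1 \<le> (1 - s + s^2) * exp s\<close>, and the second-order Taylor bound for
  \<open>exp s\<close> already makes the product at least one.\<close>

lemma exp_le_quadratic:
  fixes v :: real
  assumes "v \<le> 1"
  shows "exp v \<le> 1 + v + v\<^sup>2"
proof (cases "0 \<le> v")
  case True
  then show ?thesis using assms exp_bound by blast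
next
  case False
  define s where "s = - v"
  have s: "s > 0" using False by (simp add: s_def)
  have q: "1 + s + s\<^sup>2 / 2 \<le> exp s" using exp_lower_Taylor_quadratic[of s] s by simp
  have "(1 - s + s\<^sup>2) * (1 + s + s\<^sup>2 / 2) = 1 + (s\<^sup>2 + s * s\<^sup>2 + s\<^sup>2 * s\<^sup>2) / 2"
    by (simp add: power2_eq_square algebra_simps add_divide_distrib diff_divide_distrib)
  moreover have "0 \<le> (s\<^sup>2 + s * s\<^sup>2 + s\<^sup>2 * s\<^sup>2) / 2" using s by simp
  ultimately have "1 \<le> (1 - s + s\<^sup>2) * (1 + s + s\<^sup>2 / 2)" by linarith
  also have "\<dots> \<le> (1 - s + s\<^sup>2) * exp s"
  proof (rule mult_left_mono[OF q])
    have "1 - s + s\<^sup>2 = (1 - s/2)\<^sup>2 + 3/4 * s\<^sup>2" by (simp add: power2_eq_square algebra_simps)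
    then show "0 \<le> 1 - s + s\<^sup>2" by simp
  qed
  finally have "exp (- s) \<le> 1 - s + s\<^sup>2" by (simp add: exp_minus field_simps)
  then show ?thesis by (simp add: s_def)
qed

section \<open>Setting: increments, drift and tail exponent\<close>

locale area_walk = prob_space M for M :: "'a measure" +
  fixes X :: "nat \<Rightarrow> 'a \<Rightarrow> real" and a \<gamma> :: real and g g' :: "real \<Rightarrow> real"
  assumes indep: "indep_vars (\<lambda>_. borel) X UNIV"
    and ident: "\<And>i. distr M borel (X i) = distr M borel (X 0)"
    and a_pos: "a > 0"
    and integ: "integrable M (X 0)"
    and mean: "expectation (X 0) = - a"
    and var: "integrable M (\<lambda>\<omega>. (X 0 \<omega>)\<^sup>2)"
    and tail: "(\<lambda>x. prob {\<omega> \<in> space M. X 0 \<omega> > x}) \<sim>[at_top] (\<lambda>x. exp (- g x) * x powr (-2))"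
    and g_deriv: "\<And>x. x > 0 \<Longrightarrow> (g has_real_derivative g' x) (at x)"
    and \<gamma>: "0 < \<gamma>" "\<gamma> < 1/2"
    and g_ratio_antimono: "\<And>x y. 0 < x \<Longrightarrow> x \<le> y \<Longrightarrow> g y / y powr \<gamma> \<le> g x / x powr \<gamma>"
    and g_ratio_lim: "((\<lambda>x. g x / x powr \<gamma>) \<longlongrightarrow> 0) at_top"
    and xg'_lim: "filterlim (\<lambda>x. x * g' x) at_top at_top"
begin

lemma X_measurable [measurable]: "X i \<in> borel_measurable M"
  using indep by (auto simp: indep_vars_def)

definition Fbar :: "real \<Rightarrow> real" where
  "Fbar t = prob {\<omega> \<in> space M. X 0 \<omega> > t}"

text \<open>The comparison function of the tail assumption. Error terms are measured against it
  because it inherits the regularity of \<open>g\<close>.\<close>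

definition G :: "real \<Rightarrow> real" where
  "G t = exp (- g t) * t powr (-2)"

lemma G_nonneg: "0 \<le> G t" and G_pos: "0 < t \<Longrightarrow> 0 < G t"
  by (auto simp: G_def)

lemma Fbar_nonneg: "0 \<le> Fbar t"
  by (simp add: Fbar_def)

lemma Fbar_antimono: "s \<le> t \<Longrightarrow> Fbar t \<le> Fbar s"
  unfolding Fbar_def by (intro finite_measure_mono) auto

lemma expectation_X:
  fixes f :: "real \<Rightarrow> real"
  assumes [measurable]: "f \<in> borel_measurable borel"
  shows "expectation (\<lambda>\<omega>. f (X i \<omega>)) = expectation (\<lambda>\<omega>. f (X 0 \<omega>))"
  using integral_distr[of "X i" M borel f] integral_distr[of "X 0" M borel f] ident[of i] by simp

lemma prob_X_gt: "prob {\<omega> \<in> space M. X i \<omega> > t} = Fbar t"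
proof -
  have "prob {\<omega> \<in> space M. X i \<omega> > t} = measure (distr M borel (X i)) {t<..}" for i
    by (subst measure_distr) (auto intro!: arg_cong[where f=prob])
  then show ?thesis using ident[of i] by (simp add: Fbar_def)
qed

subsection \<open>The exponent function\<close>

text \<open>A nonincreasing ratio that tends to zero cannot be negative.\<close>

lemma g_nonneg:
  assumes "0 < y"
  shows "0 \<le> g y"
proof -
  have "eventually (\<lambda>t. g t / t powr \<gamma> \<le> g y / y powr \<gamma>) at_top"
    using eventually_ge_at_top[of y] by eventually_elim (use assms g_ratio_antimono in auto)
  then have "0 \<le> g y / y powr \<gamma>"
    by (rule tendsto_upperbound[OF g_ratio_lim]) auto
  then show ?thesis using assms by (simp add: zero_le_divide_iff)
qed

lemma g_lower:
  assumes "0 < t" "t \<le> y"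
  shows "g y * (t / y) powr \<gamma> \<le> g t"
  using g_ratio_antimono[OF assms] assms by (simp add: powr_divide field_simps)

text \<open>Once \<open>K \<le> x * g' x\<close>, the difference of \<open>g\<close> and
  \<open>K * ln\<close> has nonnegative derivative. The incremental form compares \<open>g\<close>
  at two distant arguments, as needed for long excursions.\<close>

lemma g_growth: "\<exists>t0>0. \<forall>s t. t0 \<le> s \<longrightarrow> s \<le> t \<longrightarrow> K * ln (t / s) \<le> g t - g s"
proof -
  obtain t1 where t1: "\<And>x. x \<ge> t1 \<Longrightarrow> K \<le> x * g' x"
    using xg'_lim by (auto simp: filterlim_at_top eventually_at_top_linorder)
  show ?thesis
  proof (intro exI[of _ "max 1 t1"] conjI allI impI)
    fix s t assume st: "max 1 t1 \<le> s" "s \<le> t"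
    have "g s - K * ln s \<le> g t - K * ln t"
    proof (rule DERIV_nonneg_imp_nondecreasing[OF st(2)])
      fix x assume x: "s \<le> x" "x \<le> t"
      then have x0: "x > 0" "K \<le> x * g' x" using st t1 by auto
      have "((\<lambda>x. g x - K * ln x) has_real_derivative (g' x - K * (1 / x))) (at x)"
        using x0 by (auto intro!: derivative_eq_intros g_deriv)
      moreover have "0 \<le> g' x - K * (1 / x)" using x0 by (simp add: field_simps)
      ultimately show "\<exists>y. ((\<lambda>x. g x - K * ln x) has_real_derivative y) (at x) \<and> 0 \<le> y" by blast
    qed
    then show "K * ln (t / s) \<le> g t - g s" using st by (simp add: ln_div algebra_simps)
  qed auto
qed

lemma g_superlog: "filterlim (\<lambda>t. g t - K * ln t) at_top at_top"
proof -
  \<comment> \<open>The spare unit in \<open>K + 1\<close> leaves a term \<open>ln t\<close>, which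
    diverges.\<close>
  obtain t0 where t0: "t0 > 0" "\<And>s t. t0 \<le> s \<Longrightarrow> s \<le> t \<Longrightarrow> (K + 1) * ln (t / s) \<le> g t - g s"
    using g_growth[of "K + 1"] by auto
  have "filterlim (\<lambda>t. (g t0 - (K + 1) * ln t0) + ln t) at_top at_top" by (rule filterlim_tendsto_add_at_top[OF tendsto_const ln_at_top])
  moreover have "eventually (\<lambda>t. (g t0 - (K + 1) * ln t0) + ln t \<le> g t - K * ln t) at_top"
    using eventually_ge_at_top[of t0]
  proof eventually_elim
    case (elim t)
    then show ?case using t0(2)[of t0 t] t0(1) by (simp add: ln_div algebra_simps)
  qed
  ultimately show ?thesis by (rule filterlim_at_top_mono)
qed

lemma g_at_top: "filterlim g at_top at_top"
  using g_superlog[of 0] by simp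

lemma eventually_g_ge: "eventually (\<lambda>t. c \<le> g t) at_top"
  using g_at_top by (simp add: filterlim_at_top)

lemma g_powr_lim: "((\<lambda>y. g y * y powr (-\<gamma>)) \<longlongrightarrow> 0) at_top"
  using g_ratio_lim by (simp add: powr_minus divide_inverse)

text \<open>Here \<open>\<gamma> < 1/2\<close> enters: the product is
  \<open>g y * y powr (-\<gamma>)\<close> times \<open>y powr (2 * \<gamma> - 1)\<close>. It says
  that the exponential rate is small compared with the drift slack
  \<open>y powr (-\<gamma>)\<close>.\<close>

lemma g_div_powr_lim: "((\<lambda>y. g y / y * y powr \<gamma>) \<longlongrightarrow> 0) at_top"
proof -
  have "((\<lambda>y. y powr (2 * \<gamma> - 1)) \<longlongrightarrow> 0) at_top"
    using \<gamma> by (intro tendsto_neg_powr filterlim_ident) auto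
  from tendsto_mult[OF g_powr_lim this]
  have "((\<lambda>y. g y * y powr (-\<gamma>) * y powr (2 * \<gamma> - 1)) \<longlongrightarrow> 0) at_top" by simp
  moreover have "eventually (\<lambda>y. g y * y powr (-\<gamma>) * y powr (2 * \<gamma> - 1) = g y / y * y powr \<gamma>) at_top"
    using eventually_gt_at_top[of 0]
  proof eventually_elim
    case (elim y)
    have "y powr (-\<gamma>) * y powr (2 * \<gamma> - 1) = y powr (\<gamma> - 1)"
      by (simp add: powr_add[symmetric])
    also have "\<dots> = y powr \<gamma> / y" using elim by (simp add: powr_diff)
    finally show ?case by (simp add: field_simps)
  qed
  ultimately show ?thesis by (rule Lim_transform_eventually)
qed

lemma g_div_lim: "((\<lambda>y. g y / y) \<longlongrightarrow> 0) at_top"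
proof (rule tendsto_sandwich[OF _ _ tendsto_const g_div_powr_lim])
  show "eventually (\<lambda>y. 0 \<le> g y / y) at_top"
    using eventually_gt_at_top[of 0] by eventually_elim (auto simp: g_nonneg)
  show "eventually (\<lambda>y. g y / y \<le> g y / y * y powr \<gamma>) at_top"
    using eventually_ge_at_top[of 1]
  proof eventually_elim
    case (elim y)
    have "1 \<le> y powr \<gamma>" using elim \<gamma> by (intro ge_one_powr_ge_zero) auto
    moreover have "0 \<le> g y / y" using elim g_nonneg[of y] by auto
    ultimately show ?case using mult_left_mono by fastforce
  qed
qed

lemma div_g_at_top: "filterlim (\<lambda>y. y / g y) at_top at_top"
proof -
  have "filterlim (\<lambda>y. inverse (g y / y)) at_top at_top"
  proof (rule filterlim_inverse_at_top[OF g_div_lim])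
    show "eventually (\<lambda>y. 0 < g y / y) at_top"
      using eventually_gt_at_top[of 0] eventually_g_ge[of 1] by eventually_elim auto
  qed
  then show ?thesis by simp
qed

lemma Fbar_G_lim: "((\<lambda>t. Fbar t / G t) \<longlongrightarrow> 1) at_top"
proof -
  have "eventually (\<lambda>t. Fbar t \<noteq> 0 \<or> G t \<noteq> 0) at_top"
    using eventually_gt_at_top[of 0] by eventually_elim (auto simp: G_def)
  then show ?thesis
    using tail unfolding Fbar_def G_def by (intro asymp_equivD_strong) auto
qed

lemma eventually_Fbar_le:
  assumes "\<epsilon> > 0"
  shows "eventually (\<lambda>t. Fbar t \<le> (1 + \<epsilon>) * G t) at_top"
proof -
  have "eventually (\<lambda>t. Fbar t / G t < 1 + \<epsilon>) at_top"
    using assms by (intro order_tendstoD(2)[OF Fbar_G_lim]) auto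
  with eventually_gt_at_top[of 0] show ?thesis
    by eventually_elim (use G_pos in \<open>auto simp: field_simps\<close>)
qed

lemma eventually_Fbar_ge:
  assumes "\<epsilon> > 0"
  shows "eventually (\<lambda>t. (1 - \<epsilon>) * G t \<le> Fbar t) at_top"
proof -
  have "eventually (\<lambda>t. Fbar t / G t > 1 - \<epsilon>) at_top"
    using assms by (intro order_tendstoD(1)[OF Fbar_G_lim]) auto
  with eventually_gt_at_top[of 0] show ?thesis
  proof eventually_elim
    case (elim t)
    then show ?case using G_pos[of t] by (simp add: pos_less_divide_eq less_imp_le)
  qed
qed

subsection \<open>Exponential moments of truncated increments\<close>

text \<open>Beyond exponent 1 the exponential is dominated by a step function, whose expectation is
  a finite sum of tail values; this replaces integration by parts against the tail.\<close>

lemma exp_min_pointwise: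
  assumes "\<theta> > 0" "z > 0"
  shows "exp (\<theta> * min x z) \<le> 1 + \<theta> * x + \<theta>\<^sup>2 * x\<^sup>2
     + (\<Sum>m\<in>{1..nat \<lfloor>\<theta> * z\<rfloor>}. exp (real m + 1) * indicator {x. real m / \<theta> < x} x)"
proof (cases "\<theta> * min x z \<le> 1")
  case True
  have "exp (\<theta> * min x z) \<le> 1 + \<theta> * min x z + (\<theta> * min x z)\<^sup>2"
    by (rule exp_le_quadratic[OF True])
  moreover have "\<theta> * min x z \<le> \<theta> * x" using assms by auto
  moreover have "(\<theta> * min x z)\<^sup>2 \<le> \<theta>\<^sup>2 * x\<^sup>2"
    using assms by (auto simp: power_mult_distrib min_def intro!: mult_left_mono power_mono)
  moreover have "0 \<le> (\<Sum>m\<in>{1..nat \<lfloor>\<theta> * z\<rfloor>}. exp (real m + 1) * indicator {x. real m / \<theta> < x} x)"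
    by (intro sum_nonneg) auto
  ultimately show ?thesis by linarith
next
  case False
  define v where "v = \<theta> * min x z"
  have v: "v > 1" "v \<le> \<theta> * z" "v \<le> \<theta> * x" using False assms by (auto simp: v_def)
  \<comment> \<open>Ceiling minus one rather than the floor, so that \<open>m < v\<close> strictly,
    matching the strict inequality in the indicator.\<close>
  define m where "m = nat (\<lceil>v\<rceil> - 1)"
  have m: "real m = of_int \<lceil>v\<rceil> - 1" using v by (simp add: m_def)
  have m_less: "real m < v" "v \<le> real m + 1" unfolding m by linarith+
  have m1: "1 \<le> m" using v m by (simp add: m_def) linarith
  have mM: "m \<le> nat \<lfloor>\<theta> * z\<rfloor>" using m_less v by (simp add: le_nat_floor)
  have ind: "real m / \<theta> < x" using m_less v assms by (simp add: field_simps)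
  have "exp v \<le> exp (real m + 1)" using m_less by simp
  also have "\<dots> = exp (real m + 1) * indicator {x. real m / \<theta> < x} x" using ind by simp
  also have "\<dots> \<le> (\<Sum>m\<in>{1..nat \<lfloor>\<theta> * z\<rfloor>}. exp (real m + 1) * indicator {x. real m / \<theta> < x} x)"
    using m1 mM by (intro member_le_sum) auto
  finally have "exp v \<le> (\<Sum>m\<in>{1..nat \<lfloor>\<theta> * z\<rfloor>}. exp (real m + 1) * indicator {x. real m / \<theta> < x} x)" .
  \<comment> \<open>The quadratic part is nonnegative everywhere, so adding it to the step function
    keeps an upper bound.\<close>
  moreover have "1 + \<theta> * x + \<theta>\<^sup>2 * x\<^sup>2 = (1/2 + \<theta> * x)\<^sup>2 + 3/4"
    by (simp add: power2_eq_square algebra_simps)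
  then have "0 \<le> 1 + \<theta> * x + \<theta>\<^sup>2 * x\<^sup>2" by simp
  ultimately show ?thesis unfolding v_def by linarith
qed

lemma integrable_exp_min:
  assumes "\<theta> \<ge> 0"
  shows "integrable M (\<lambda>\<omega>. exp (\<theta> * min (X i \<omega>) z))"
  by (rule integrable_const_bound[where B="exp (\<theta> * z)"]) (use assms in \<open>auto intro!: mult_left_mono\<close>)

text \<open>With \<open>\<theta> = g z / z\<close>, monotonicity of \<open>g x / x powr \<gamma>\<close> gives \<open>\<theta> t \<le> g t\<close> on \<open>[0, z]\<close>, so
  \<open>exp (\<theta> t)\<close> is compensated by the tail up to \<open>t powr (-2)\<close>, which only costs \<open>O(\<theta>\<^sup>2)\<close>.\<close>

lemma exp_moment_truncated:
  "\<exists>C>0. eventually (\<lambda>z. \<forall>i. expectation (\<lambda>\<omega>. exp (g z / z * min (X i \<omega>) z))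
      \<le> exp (- a * (g z / z) + C * (g z / z)\<^sup>2)) at_top"
proof -
  define K where "K = (\<Sum>m. inverse (real m ^ 2))"
  have sumK: "summable (\<lambda>m. inverse (real m ^ 2))" by (rule inverse_power_summable) auto
  define V where "V = expectation (\<lambda>\<omega>. (X 0 \<omega>)\<^sup>2)"
  have V0: "0 \<le> V" unfolding V_def by simp
  have K0: "0 \<le> K" unfolding K_def by (intro suminf_nonneg sumK) auto
  define C where "C = V + 2 * exp 1 * K + 1"
  have C: "C > 0" unfolding C_def using V0 K0 by (simp add: add_nonneg_pos)
  obtain t0 where t0: "t0 > 0" "\<And>t. t \<ge> t0 \<Longrightarrow> Fbar t \<le> 2 * G t"
  proof -
    obtain t1 where "\<And>t. t \<ge> t1 \<Longrightarrow> Fbar t \<le> 2 * G t"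
      using eventually_Fbar_le[of 1] by (auto simp: eventually_at_top_linorder)
    then show ?thesis by (intro that[of "max 1 t1"]) auto
  qed
  \<comment> \<open>The smallest argument at which the tail is evaluated is
    \<open>1 / \<theta> = z / g z\<close>; once it passes \<open>t0\<close>, the tail bound applies
    to all of them.\<close>
  have ev: "eventually (\<lambda>z. t0 \<le> z / g z) at_top"
    using div_g_at_top by (simp add: filterlim_at_top)
  have "eventually (\<lambda>z. \<forall>i. expectation (\<lambda>\<omega>. exp (g z / z * min (X i \<omega>) z))
      \<le> exp (- a * (g z / z) + C * (g z / z)\<^sup>2)) at_top"
    using ev eventually_gt_at_top[of 0] eventually_g_ge[of 1]
  proof eventually_elim
    case (elim z)
    define \<theta> where "\<theta> = g z / z"
    have \<theta>: "\<theta> > 0" "\<theta> * z = g z" using elim by (auto simp: \<theta>_def)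
    let ?N = "nat \<lfloor>\<theta> * z\<rfloor>"
    have summand: "exp (real m + 1) * Fbar (real m / \<theta>) \<le> 2 * exp 1 * \<theta>\<^sup>2 * inverse (real m ^ 2)" 
      if m: "m \<in> {1..?N}" for m
    proof -
      let ?t = "real m / \<theta>"
      have m1: "1 \<le> real m" "real m \<le> g z" using m elim \<theta> by auto linarith
      have "t0 \<le> 1 / \<theta>" using elim by (simp add: \<theta>_def)
      also have "\<dots> \<le> ?t" using m1 \<theta> by (simp add: divide_right_mono)
      finally have tt0: "t0 \<le> ?t" .
      have tz: "?t \<le> z" using m1 \<theta> by (simp add: field_simps)
      have t_pos: "0 < ?t" using tt0 t0 by linarith
      have "real m = g z * (?t / z)" using \<theta> elim by (simp add: field_simps)
      also have "\<dots> \<le> g z * (?t / z) powr \<gamma>"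
      proof (rule mult_left_mono)
        have "(?t / z) powr 1 \<le> (?t / z) powr \<gamma>"
          using \<gamma> tz t_pos elim(2) by (intro powr_mono') (auto simp del: divide_divide_eq_left)
        then show "?t / z \<le> (?t / z) powr \<gamma>"
          using t_pos elim \<theta>(1) by (simp del: divide_divide_eq_left)
      qed (use elim in auto)
      also have "\<dots> \<le> g ?t" by (rule g_lower[OF t_pos tz])
      finally have gt: "real m \<le> g ?t" .
      have "exp (real m + 1) * Fbar ?t \<le> exp (real m + 1) * (2 * G ?t)"
        by (intro mult_left_mono t0(2) tt0) auto
      also have "\<dots> = 2 * exp 1 * (exp (real m - g ?t)) * ?t powr (-2)"
        by (simp add: G_def exp_add exp_diff exp_minus field_simps)
      also have "\<dots> \<le> 2 * exp 1 * 1 * ?t powr (-2)"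
        using gt by (intro mult_right_mono mult_left_mono) auto
      also have "?t powr (-2) = \<theta>\<^sup>2 * inverse (real m ^ 2)"
        using t_pos \<theta> m1 by (simp add: powr_minus powr_numeral power_divide field_simps)
      finally show ?thesis by simp
    qed
    have main: "expectation (\<lambda>\<omega>. exp (\<theta> * min (X 0 \<omega>) z)) \<le> 1 - a * \<theta> + C * \<theta>\<^sup>2"
    proof -
      let ?I = "\<lambda>m \<omega>. exp (real m + 1) * indicator {x. real m / \<theta> < x} (X 0 \<omega>) :: real"
      have Iint: "integrable M (?I m)" for m
        by (intro integrable_mult_right integrable_const_bound[where B=1]) (auto simp: indicator_def)
      have EI: "expectation (?I m) = exp (real m + 1) * Fbar (real m / \<theta>)" for m
      proof -
        have "expectation (\<lambda>\<omega>. indicator {x. real m / \<theta> < x} (X 0 \<omega>) :: real)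
            = expectation (indicator {\<omega> \<in> space M. real m / \<theta> < X 0 \<omega>})"
          by (intro Bochner_Integration.integral_cong) (auto simp: indicator_def)
        also have "\<dots> = Fbar (real m / \<theta>)"
          by (simp add: Fbar_def Int_absorb2 Collect_restrict)
        finally show ?thesis by simp
      qed
      have Sint: "integrable M (\<lambda>\<omega>. \<Sum>m\<in>{1..?N}. ?I m \<omega>)"
        by (intro Bochner_Integration.integrable_sum Iint)
      have Q: "integrable M (\<lambda>\<omega>. 1 + \<theta> * X 0 \<omega> + \<theta>\<^sup>2 * (X 0 \<omega>)\<^sup>2)"
        using integ var by simp
      have "expectation (\<lambda>\<omega>. exp (\<theta> * min (X 0 \<omega>) z))
        \<le> expectation (\<lambda>\<omega>. (1 + \<theta> * X 0 \<omega> + \<theta>\<^sup>2 * (X 0 \<omega>)\<^sup>2) + (\<Sum>m\<in>{1..?N}. ?I m \<omega>))"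
        by (rule integral_mono[OF integrable_exp_min Bochner_Integration.integrable_add[OF Q Sint]])
           (use \<theta>(1) elim(2) exp_min_pointwise in \<open>simp_all only: less_imp_le\<close>)
      also have "\<dots> = expectation (\<lambda>\<omega>. 1 + \<theta> * X 0 \<omega> + \<theta>\<^sup>2 * (X 0 \<omega>)\<^sup>2) + expectation (\<lambda>\<omega>. \<Sum>m\<in>{1..?N}. ?I m \<omega>)"
        by (rule Bochner_Integration.integral_add[OF Q Sint])
      also have "expectation (\<lambda>\<omega>. 1 + \<theta> * X 0 \<omega> + \<theta>\<^sup>2 * (X 0 \<omega>)\<^sup>2) = 1 + \<theta> * (- a) + \<theta>\<^sup>2 * V"
        using integ var by (simp add: V_def mean prob_space)
      also have "expectation (\<lambda>\<omega>. \<Sum>m\<in>{1..?N}. ?I m \<omega>) = (\<Sum>m\<in>{1..?N}. exp (real m + 1) * Fbar (real m / \<theta>))"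
        unfolding EI[symmetric] by (rule Bochner_Integration.integral_sum[OF Iint])
      also have "(\<Sum>m\<in>{1..?N}. exp (real m + 1) * Fbar (real m / \<theta>))
         \<le> (\<Sum>m\<in>{1..?N}. 2 * exp 1 * \<theta>\<^sup>2 * inverse (real m ^ 2))"
        by (rule sum_mono[OF summand])
      also have "\<dots> = 2 * exp 1 * \<theta>\<^sup>2 * (\<Sum>m\<in>{1..?N}. inverse (real m ^ 2))"
        by (simp add: sum_distrib_left)
      also have "\<dots> \<le> 2 * exp 1 * \<theta>\<^sup>2 * K"
        unfolding K_def by (intro mult_left_mono sum_le_suminf sumK) auto
      finally have "expectation (\<lambda>\<omega>. exp (\<theta> * min (X 0 \<omega>) z)) \<le> 1 - a * \<theta> + (V + 2 * exp 1 * K) * \<theta>\<^sup>2"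
        by (simp add: algebra_simps)
      also have "\<dots> \<le> 1 - a * \<theta> + C * \<theta>\<^sup>2" by (simp add: C_def mult_right_mono)
      finally show ?thesis .
    qed
    also have "\<dots> \<le> exp (- a * \<theta> + C * \<theta>\<^sup>2)"
      using exp_ge_add_one_self[of "- a * \<theta> + C * \<theta>\<^sup>2"] by linarith
    finally have "expectation (\<lambda>\<omega>. exp (\<theta> * min (X i \<omega>) z)) \<le> exp (- a * \<theta> + C * \<theta>\<^sup>2)" for i
      by (subst expectation_X) auto
    then show ?case unfolding \<theta>_def by blast
  qed
  with C show ?thesis by blast
qed

text \<open>Adding back the drift \<open>a\<close> less the slack
  \<open>c * z powr (-\<gamma>)\<close> leaves an exponential moment at most one as soon as
  \<open>C * \<theta>\<close> is below the slack. The injection \<open>\<iota>\<close> covers the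
  walk with one increment removed.\<close>

lemma truncated_maximum:
  assumes c: "c > 0"
  shows "eventually (\<lambda>z. \<forall>(\<iota> :: nat \<Rightarrow> nat) n u. inj \<iota> \<longrightarrow>
     prob {\<omega> \<in> space M. \<exists>j\<le>n. u \<le> (\<Sum>i<j. min (X (\<iota> i) \<omega>) z + a - c * z powr (-\<gamma>))}
       \<le> exp (- (g z / z) * u)) at_top"
proof -
  obtain C where C: "C > 0" and ev: "eventually (\<lambda>z. \<forall>i. expectation (\<lambda>\<omega>. exp (g z / z * min (X i \<omega>) z))
      \<le> exp (- a * (g z / z) + C * (g z / z)\<^sup>2)) at_top"
    using exp_moment_truncated by blast
  have "eventually (\<lambda>z. g z / z * z powr \<gamma> < c / C) at_top"
    using c C by (intro order_tendstoD(2)[OF g_div_powr_lim]) auto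
  with ev eventually_gt_at_top[of 0] show ?thesis
  proof eventually_elim
    case (elim z)
    define \<theta> where "\<theta> = g z / z"
    have \<theta>: "\<theta> \<ge> 0" using elim g_nonneg[of z] by (auto simp: \<theta>_def)
    have "\<theta> * z powr \<gamma> < c / C" using elim by (simp add: \<theta>_def)
    then have small: "C * \<theta> \<le> c * z powr (-\<gamma>)"
      using elim C by (simp add: powr_minus field_simps)
    define f where "f x = min x z + a - c * z powr (-\<gamma>)" for x :: real
    have [measurable]: "f \<in> borel_measurable borel" unfolding f_def by measurable
    have eq: "exp (\<theta> * f x) = exp (\<theta> * (a - c * z powr (-\<gamma>))) * exp (\<theta> * min x z)" for x
      by (simp add: f_def exp_add[symmetric] algebra_simps)
    have int: "integrable M (\<lambda>\<omega>. exp (\<theta> * f (X i \<omega>)))" for i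
      unfolding eq by (intro integrable_mult_right integrable_exp_min \<theta>)
    have le1: "expectation (\<lambda>\<omega>. exp (\<theta> * f (X i \<omega>))) \<le> 1" for i
    proof -
      have "expectation (\<lambda>\<omega>. exp (\<theta> * f (X i \<omega>)))
          = exp (\<theta> * (a - c * z powr (-\<gamma>))) * expectation (\<lambda>\<omega>. exp (\<theta> * min (X i \<omega>) z))"
        unfolding eq by simp
      also have "\<dots> \<le> exp (\<theta> * (a - c * z powr (-\<gamma>))) * exp (- a * \<theta> + C * \<theta>\<^sup>2)"
        using elim(1) by (intro mult_left_mono) (auto simp: \<theta>_def)
      also have "\<dots> = exp (\<theta> * (C * \<theta> - c * z powr (-\<gamma>)))"
        by (simp add: exp_add[symmetric] algebra_simps power2_eq_square)
      also have "\<dots> \<le> 1" using \<theta> small by (simp add: mult_nonneg_nonpos)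
      finally show ?thesis .
    qed
    have "prob {\<omega> \<in> space M. \<exists>j\<le>n. u \<le> (\<Sum>i<j. f (X (\<iota> i) \<omega>))} \<le> exp (- \<theta> * u)"
      if "inj \<iota>" for \<iota> :: "nat \<Rightarrow> nat" and n u
      by (intro exp_maximal_inequality[of X _ \<theta> f] indep that \<theta> int le1) measurable
    then show ?case unfolding f_def \<theta>_def by blast
  qed
qed

end

text \<open>A substitute for independence when survival and the maximum of the remaining walk share
  increments: both factors keep half of their exponential decay.\<close>

lemma (in prob_space) prob_le_geometric_mean:
  assumes "A \<in> events" "B \<in> events"
  shows "prob (A \<inter> B) \<le> sqrt (prob A) * sqrt (prob B)"
proof -
  have "prob (A \<inter> B) = sqrt (prob (A \<inter> B)) * sqrt (prob (A \<inter> B))" by simp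
  also have "\<dots> \<le> sqrt (prob A) * sqrt (prob B)"
    using assms by (intro mult_mono real_sqrt_le_mono finite_measure_mono) auto
  finally show ?thesis .
qed

context area_walk
begin

subsection \<open>Insensitivity of the tail\<close>

text \<open>With \<open>q = v / y \<le> 1/2\<close> one has
  \<open>(1 - q) powr \<gamma> \<ge> sqrt (1 - q) \<ge> 1 - 3/5 * q\<close>; the last step is
  concavity, as 3/5 exceeds \<open>2 - sqrt 2\<close>.\<close>

lemma g_diff_le:
  assumes "0 < y" "0 \<le> v" "v \<le> y / 2"
  shows "g y - 3/5 * (g y / y) * v \<le> g (y - v)"
proof -
  define q where "q = v / y"
  have q: "0 \<le> q" "q \<le> 1/2" using assms by (auto simp: q_def field_simps)
  have "(1 - 3/5 * q)\<^sup>2 \<le> 1 - q"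
  proof -
    have "1 - q - (1 - 3/5 * q)\<^sup>2 = q * (1/5 - 9/25 * q)"
      by (simp add: power2_eq_square algebra_simps)
    moreover have "0 \<le> q * (1/5 - 9/25 * q)" using q by (intro mult_nonneg_nonneg) auto
    ultimately show ?thesis by linarith
  qed
  then have "1 - 3/5 * q \<le> sqrt (1 - q)" by (rule real_le_rsqrt)
  also have "\<dots> = (1 - q) powr (1/2)" using q by (simp add: powr_half_sqrt)
  also have "\<dots> \<le> (1 - q) powr \<gamma>" using \<gamma> q by (intro powr_mono') auto
  finally have "g y * (1 - 3/5 * q) \<le> g y * (1 - q) powr \<gamma>"
    using g_nonneg[OF assms(1)] by (rule mult_left_mono)
  also have "1 - q = (y - v) / y" using assms by (simp add: q_def field_simps)
  also have "g y * ((y - v) / y) powr \<gamma> \<le> g (y - v)" using assms by (intro g_lower) auto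
  finally show ?thesis by (simp add: q_def algebra_simps)
qed

lemma g_half: "0 < y \<Longrightarrow> 7/10 * g y \<le> g (y / 2)"
  using g_diff_le[of y "y / 2"] by (simp add: field_simps)

lemma g_scale:
  assumes "0 < e" "e \<le> 1" "0 < y"
  shows "g y / y / sqrt e \<le> g (e * y) / (e * y)"
proof -
  have "g y * sqrt e \<le> g y * e powr \<gamma>"
    using assms \<gamma> g_nonneg[of y] unfolding powr_half_sqrt[symmetric, OF less_imp_le[OF assms(1)]]
    by (intro mult_left_mono powr_mono') auto
  also have "\<dots> \<le> g (e * y)" using g_lower[of "e * y" y] assms by (simp add: mult_le_cancel_right)
  finally have "g y * sqrt e / (e * y) \<le> g (e * y) / (e * y)"
    using assms by (intro divide_right_mono) auto
  moreover have "g y * sqrt e / (e * y) = g y / y / sqrt e"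
    using assms real_sqrt_mult_self[of e] by (simp add: field_simps)
  ultimately show ?thesis by simp
qed

text \<open>A crude bound, but uniform down to \<open>y / 2\<close>: the factor 8 is 2 from the tail
  comparison times 4 from \<open>(y / 2) powr (-2)\<close>.\<close>

lemma eventually_Fbar_shift_le:
  "eventually (\<lambda>y. \<forall>v. 0 \<le> v \<longrightarrow> v \<le> y / 2 \<longrightarrow> Fbar (y - v) \<le> 8 * G y * exp (3/5 * (g y / y) * v)) at_top"
proof -
  obtain t0 where t0: "\<And>t. t \<ge> t0 \<Longrightarrow> Fbar t \<le> 2 * G t"
    using eventually_Fbar_le[of 1] by (auto simp: eventually_at_top_linorder)
  show ?thesis
    using eventually_gt_at_top[of 0] eventually_ge_at_top[of "2 * t0"]
  proof eventually_elim
    case (elim y)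
    show ?case
    proof (intro allI impI)
      fix v assume v: "0 \<le> v" "v \<le> y / 2"
      have "(y - v) powr (-2) \<le> (y / 2) powr (-2)" using v elim by (intro powr_mono2') auto
      also have "\<dots> = 4 * y powr (-2)" using elim by (simp add: powr_divide powr_minus powr_numeral field_simps)
      finally have p: "(y - v) powr (-2) \<le> 4 * y powr (-2)" .
      have "Fbar (y - v) \<le> 2 * (exp (- g (y - v)) * (y - v) powr (-2))"
        using t0[of "y - v"] v elim by (simp add: G_def)
      also have "\<dots> \<le> 2 * (exp (- (g y - 3/5 * (g y / y) * v)) * (4 * y powr (-2)))"
        using p g_diff_le[of y v] v elim by (intro mult_left_mono mult_mono) auto
      also have "\<dots> = 8 * G y * exp (3/5 * (g y / y) * v)"
        by (simp add: G_def exp_diff exp_minus field_simps)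
      finally show "Fbar (y - v) \<le> 8 * G y * exp (3/5 * (g y / y) * v)" .
    qed
  qed
qed

text \<open>On the scale \<open>y / g y\<close> the polynomial factor tends to one, so only an
  exponential of the shift survives, and it tends to one with \<open>\<kappa>\<close>.\<close>

lemma eventually_Fbar_shift_sharp:
  assumes \<kappa>: "\<kappa> > 0" and \<epsilon>: "\<epsilon> > 0"
  shows "eventually (\<lambda>y. Fbar (y - \<kappa> * (y / g y)) \<le> (1 + \<epsilon>) * exp (3/5 * \<kappa>) * G y) at_top"
proof -
  \<comment> \<open>Two factors \<open>1 + \<epsilon>1\<close> arise, from the tail equivalence and
    from the power; their product must stay below \<open>1 + \<epsilon>\<close>.\<close>
  define \<epsilon>1 where "\<epsilon>1 = min 1 (\<epsilon> / 3)"
  have \<epsilon>1: "\<epsilon>1 > 0" "\<epsilon>1 \<le> 1" "3 * \<epsilon>1 \<le> \<epsilon>" using \<epsilon> by (auto simp: \<epsilon>1_def)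
  have "\<epsilon>1 * \<epsilon>1 \<le> 1 * \<epsilon>1" using \<epsilon>1 by (intro mult_right_mono) auto
  moreover have "(1 + \<epsilon>1) * (1 + \<epsilon>1) = 1 + 2 * \<epsilon>1 + \<epsilon>1 * \<epsilon>1" by (simp add: algebra_simps)
  ultimately have sq: "(1 + \<epsilon>1) * (1 + \<epsilon>1) \<le> 1 + \<epsilon>" using \<epsilon>1 by linarith
  obtain t0 where t0: "\<And>t. t \<ge> t0 \<Longrightarrow> Fbar t \<le> (1 + \<epsilon>1) * G t"
    using eventually_Fbar_le[OF \<epsilon>1(1)] by (auto simp: eventually_at_top_linorder)
  have "((\<lambda>s::real. (1 - \<kappa> * s) powr (-2)) \<longlongrightarrow> (1 - \<kappa> * 0) powr (-2)) (nhds 0)"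
    by (intro tendsto_intros filterlim_ident) auto
  moreover have "filterlim (\<lambda>y. inverse (g y)) (nhds 0) at_top"
    by (rule tendsto_inverse_0_at_top[OF g_at_top])
  ultimately have "((\<lambda>y. (1 - \<kappa> * inverse (g y)) powr (-2)) \<longlongrightarrow> 1) at_top"
    using filterlim_compose by fastforce
  then have "eventually (\<lambda>y. (1 - \<kappa> * inverse (g y)) powr (-2) < 1 + \<epsilon>1) at_top"
    using \<epsilon>1 by (intro order_tendstoD) auto
  then show ?thesis
    using eventually_gt_at_top[of 0] eventually_ge_at_top[of "2 * t0"] eventually_g_ge[of "2 * \<kappa>"] eventually_g_ge[of 1]
  proof eventually_elim
    case (elim y)
    define v where "v = \<kappa> * (y / g y)"
    have v: "0 \<le> v" "v \<le> y / 2" using \<kappa> elim by (auto simp: v_def field_simps)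
    have yv: "y - v = y * (1 - \<kappa> * inverse (g y))" by (simp add: v_def field_simps)
    have "0 \<le> 1 - \<kappa> * inverse (g y)" using elim by (simp add: field_simps)
    then have "(y - v) powr (-2) = y powr (-2) * (1 - \<kappa> * inverse (g y)) powr (-2)"
      using elim unfolding yv by (intro powr_mult)
    also have "\<dots> \<le> y powr (-2) * (1 + \<epsilon>1)" using elim by (intro mult_left_mono) auto
    finally have p: "(y - v) powr (-2) \<le> (1 + \<epsilon>1) * y powr (-2)" by (simp add: mult.commute)
    have gv: "g y - 3/5 * \<kappa> \<le> g (y - v)"
      using g_diff_le[of y v] v elim by (simp add: v_def)
    have "Fbar (y - v) \<le> (1 + \<epsilon>1) * (exp (- g (y - v)) * (y - v) powr (-2))"
      using t0[of "y - v"] v elim by (simp add: G_def)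
    also have "\<dots> \<le> (1 + \<epsilon>1) * (exp (- (g y - 3/5 * \<kappa>)) * ((1 + \<epsilon>1) * y powr (-2)))"
      using p gv \<epsilon>1 by (intro mult_left_mono mult_mono) auto
    also have "exp (- (g y - 3/5 * \<kappa>)) = exp (3/5 * \<kappa>) * exp (- g y)"
      by (simp add: exp_add[symmetric])
    also have "(1 + \<epsilon>1) * (exp (3/5 * \<kappa>) * exp (- g y) * ((1 + \<epsilon>1) * y powr (-2)))
        = ((1 + \<epsilon>1) * (1 + \<epsilon>1)) * (exp (3/5 * \<kappa>) * G y)"
      by (simp add: G_def)
    also have "\<dots> \<le> (1 + \<epsilon>) * (exp (3/5 * \<kappa>) * G y)"
      using sq by (intro mult_right_mono mult_nonneg_nonneg G_nonneg) auto
    finally show ?case by (simp add: v_def mult.assoc)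
  qed
qed

text \<open>Since \<open>\<gamma> < 1\<close>, also \<open>g x / x\<close> is nonincreasing, whence
  a shift by \<open>\<eta> * (y / g y)\<close> raises \<open>g\<close> by at most
  \<open>\<eta>\<close>.\<close>

lemma eventually_Fbar_shift_ge:
  assumes \<eta>: "\<eta> > 0" and \<epsilon>: "\<epsilon> > 0" "\<epsilon> < 1"
  shows "eventually (\<lambda>y. (1 - \<epsilon>) * exp (- \<eta>) * G y \<le> Fbar (y + \<eta> * (y / g y))) at_top"
proof -
  define \<epsilon>1 where "\<epsilon>1 = \<epsilon> / 2"
  have \<epsilon>1: "\<epsilon>1 > 0" "\<epsilon>1 < 1" using \<epsilon> by (auto simp: \<epsilon>1_def)
  have sq: "1 - \<epsilon> \<le> (1 - \<epsilon>1) * (1 - \<epsilon>1)" using \<epsilon>1 by (simp add: \<epsilon>1_def algebra_simps)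
  obtain t0 where t0: "\<And>t. t \<ge> t0 \<Longrightarrow> (1 - \<epsilon>1) * G t \<le> Fbar t"
    using eventually_Fbar_ge[OF \<epsilon>1(1)] by (auto simp: eventually_at_top_linorder)
  have "((\<lambda>s::real. (1 + \<eta> * s) powr (-2)) \<longlongrightarrow> (1 + \<eta> * 0) powr (-2)) (nhds 0)"
    by (intro tendsto_intros filterlim_ident) auto
  moreover have "filterlim (\<lambda>y. inverse (g y)) (nhds 0) at_top"
    by (rule tendsto_inverse_0_at_top[OF g_at_top])
  ultimately have "((\<lambda>y. (1 + \<eta> * inverse (g y)) powr (-2)) \<longlongrightarrow> 1) at_top"
    using filterlim_compose by fastforce
  then have "eventually (\<lambda>y. (1 + \<eta> * inverse (g y)) powr (-2) > 1 - \<epsilon>1) at_top"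
    using \<epsilon>1 by (intro order_tendstoD) auto
  then show ?thesis
    using eventually_gt_at_top[of 0] eventually_ge_at_top[of t0] eventually_g_ge[of 1]
  proof eventually_elim
    case (elim y)
    define w where "w = \<eta> * (y / g y)"
    have w: "0 \<le> w" using \<eta> elim by (auto simp: w_def)
    have yw: "y + w = y * (1 + \<eta> * inverse (g y))" by (simp add: w_def field_simps)
    have s: "0 \<le> \<eta> * inverse (g y)" using elim \<eta> by simp
    have "y powr (-2) * (1 - \<epsilon>1) \<le> y powr (-2) * (1 + \<eta> * inverse (g y)) powr (-2)"
      using elim by (intro mult_left_mono) auto
    also have "\<dots> = (y + w) powr (-2)"
      using elim s unfolding yw by (intro powr_mult[symmetric])
    finally have p: "(1 - \<epsilon>1) * y powr (-2) \<le> (y + w) powr (-2)" by (simp add: mult.commute)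
    have "g (y + w) * (y / (y + w)) powr \<gamma> \<le> g y" using w elim by (intro g_lower) auto
    moreover have "y / (y + w) \<le> (y / (y + w)) powr \<gamma>"
      using powr_mono'[of \<gamma> 1 "y / (y + w)"] \<gamma> w elim by simp
    then have "g (y + w) * (y / (y + w)) \<le> g (y + w) * (y / (y + w)) powr \<gamma>"
      using w elim by (intro mult_left_mono g_nonneg) auto
    ultimately have "g (y + w) * (y / (y + w)) \<le> g y" by linarith
    then have "g (y + w) \<le> g y * ((y + w) / y)" using w elim by (simp add: field_simps)
    also have "\<dots> = g y + \<eta>" using elim by (simp add: w_def field_simps)
    finally have gw: "g (y + w) \<le> g y + \<eta>" .
    have "(1 - \<epsilon>) * (exp (- \<eta>) * G y) \<le> ((1 - \<epsilon>1) * (1 - \<epsilon>1)) * (exp (- \<eta>) * G y)"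
      using sq by (intro mult_right_mono mult_nonneg_nonneg G_nonneg) auto
    also have "\<dots> = (1 - \<epsilon>1) * ((exp (- \<eta>) * exp (- g y)) * ((1 - \<epsilon>1) * y powr (-2)))"
      by (simp add: G_def)
    also have "exp (- \<eta>) * exp (- g y) = exp (- (g y + \<eta>))"
      by (simp add: exp_add[symmetric])
    also have "(1 - \<epsilon>1) * (exp (- (g y + \<eta>)) * ((1 - \<epsilon>1) * y powr (-2)))
       \<le> (1 - \<epsilon>1) * (exp (- g (y + w)) * (y + w) powr (-2))"
      using p gw \<epsilon>1 by (intro mult_left_mono mult_mono) auto
    also have "\<dots> \<le> Fbar (y + w)" using t0[of "y + w"] w elim by (simp add: G_def)
    finally show ?case by (simp add: w_def mult.assoc)
  qed
qed

text \<open>The surplus \<open>c * g y\<close> has to beat the \<open>2 * ln y\<close> hidden in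
  \<open>G y\<close>, which is superlogarithmic growth with constant \<open>2 / c\<close>.\<close>

lemma eventually_exp_le_G:
  assumes c: "c > 0" and \<epsilon>: "\<epsilon> > 0"
  shows "eventually (\<lambda>y. exp (- (1 + c) * g y) \<le> \<epsilon> * G y) at_top"
proof -
  have "eventually (\<lambda>y. - ln \<epsilon> / c \<le> g y - 2 / c * ln y) at_top"
    using g_superlog[of "2 / c"] by (simp add: filterlim_at_top)
  then show ?thesis using eventually_gt_at_top[of 0]
  proof eventually_elim
    case (elim y)
    have "c * (- ln \<epsilon> / c) \<le> c * (g y - 2 / c * ln y)" using elim c by (intro mult_left_mono) auto
    then have "- ln \<epsilon> \<le> c * (g y - 2 / c * ln y)" using c by simp
    also have "\<dots> = c * g y - 2 * ln y" using c by (simp add: field_simps)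
    finally have "- (1 + c) * g y \<le> ln \<epsilon> + (- g y + (-2) * ln y)" by (simp add: algebra_simps)
    then have "exp (- (1 + c) * g y) \<le> exp (ln \<epsilon> + (- g y + (-2) * ln y))" by simp
    also have "\<dots> = \<epsilon> * G y" using \<epsilon> elim unfolding exp_add by (simp add: G_def powr_def)
    finally show ?case .
  qed
qed

subsection \<open>Maxima of truncated walks\<close>

text \<open>With \<open>id\<close> this concerns the whole walk, with \<open>skip k\<close> the walk
  without \<open>X k\<close>. The empty sum at \<open>j = 0\<close> makes every level
  \<open>u \<le> 0\<close> exceeded, so a jump that suffices alone needs no separate case.\<close>

definition exceeds :: "(nat \<Rightarrow> nat) \<Rightarrow> nat \<Rightarrow> real \<Rightarrow> real \<Rightarrow> 'a \<Rightarrow> bool" where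
  "exceeds \<iota> n y u \<omega> \<longleftrightarrow> (\<exists>j\<le>n. u \<le> (\<Sum>i<j. min (X (\<iota> i) \<omega>) (y / 2) + a - y powr (-\<gamma>)))"

lemma exceeds_measurable [measurable]: "Measurable.pred M (exceeds \<iota> n y u)"
  unfolding exceeds_def by measurable

lemma exceeds_mono: "exceeds \<iota> n y u \<omega> \<Longrightarrow> u' \<le> u \<Longrightarrow> exceeds \<iota> n y u' \<omega>"
  unfolding exceeds_def by (meson order_trans)

text \<open>The rate 7/5 is twice the 7/10 of \<open>g_half\<close>, because the truncation level in
  the denominator is \<open>y / 2\<close>.\<close>

lemma eventually_exceeds_le:
  "eventually (\<lambda>y. \<forall>\<iota> n u. inj \<iota> \<longrightarrow> 0 \<le> u \<longrightarrow>
      prob {\<omega> \<in> space M. exceeds \<iota> n y u \<omega>} \<le> exp (- (7/5) * (g y / y) * u)) at_top"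
proof -
  have "filterlim (\<lambda>y::real. y / 2) at_top at_top"
    using filterlim_tendsto_pos_mult_at_top[OF tendsto_const[of "1/2 :: real"] _ filterlim_ident] by simp
  \<comment> \<open>This choice of the slack constant turns the slack at truncation level
    \<open>y / 2\<close> into exactly \<open>y powr (-\<gamma>)\<close>.\<close>
  moreover have "0 < (2::real) powr (-\<gamma>)" by simp
  ultimately have "eventually (\<lambda>y. \<forall>(\<iota> :: nat \<Rightarrow> nat) n u. inj \<iota> \<longrightarrow>
     prob {\<omega> \<in> space M. \<exists>j\<le>n. u \<le> (\<Sum>i<j. min (X (\<iota> i) \<omega>) (y / 2) + a - 2 powr (-\<gamma>) * (y / 2) powr (-\<gamma>))}
       \<le> exp (- (g (y / 2) / (y / 2)) * u)) at_top"
    by (rule eventually_compose_filterlim[OF truncated_maximum, rotated])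
  then show ?thesis using eventually_gt_at_top[of 0]
  proof eventually_elim
    case (elim y)
    have eq: "2 powr (-\<gamma>) * (y / 2) powr (-\<gamma>) = y powr (-\<gamma>)"
      using elim by (simp add: powr_mult[symmetric])
    show ?case
    proof (intro allI impI)
      fix \<iota> :: "nat \<Rightarrow> nat" and n and u :: real assume \<iota>: "inj \<iota>" and u: "0 \<le> u"
      have "7/5 * (g y / y) \<le> g (y / 2) / (y / 2)"
        using g_half[of y] elim by (simp add: field_simps)
      then have "7/5 * (g y / y) * u \<le> g (y / 2) / (y / 2) * u" using u by (rule mult_right_mono)
      moreover have "prob {\<omega> \<in> space M. exceeds \<iota> n y u \<omega>} \<le> exp (- (g (y / 2) / (y / 2)) * u)"
        using elim \<iota> unfolding exceeds_def by (simp only: eq)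
      ultimately show "prob {\<omega> \<in> space M. exceeds \<iota> n y u \<omega>} \<le> exp (- (7/5) * (g y / y) * u)"
        by (smt (verit) exp_le_cancel_iff mult_minus_left)
    qed
  qed
qed

lemma prob_ex_X_gt_le:
  fixes \<iota> :: "nat \<Rightarrow> nat"
  shows "prob {\<omega> \<in> space M. \<exists>i<n. X (\<iota> i) \<omega> > t} \<le> real n * Fbar t"
proof -
  have "{\<omega> \<in> space M. \<exists>i<n. X (\<iota> i) \<omega> > t} = (\<Union>i<n. {\<omega> \<in> space M. X (\<iota> i) \<omega> > t})" by auto
  then have "prob {\<omega> \<in> space M. \<exists>i<n. X (\<iota> i) \<omega> > t} \<le> (\<Sum>i<n. prob {\<omega> \<in> space M. X (\<iota> i) \<omega> > t})"
    by (simp only:) (rule finite_measure_subadditive_finite, auto)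
  also have "\<dots> = real n * Fbar t" by (simp add: prob_X_gt)
  finally show ?thesis .
qed

text \<open>Truncating at \<open>e y\<close> instead of \<open>y / 2\<close> improves the exponential rate by the factor \<open>1 / sqrt e\<close>.\<close>

lemma eventually_exceeds_le_refined:
  assumes e: "0 < e" "e \<le> 1/2"
  shows "eventually (\<lambda>y. \<forall>\<iota> n u. inj \<iota> \<longrightarrow> 0 \<le> u \<longrightarrow>
      prob {\<omega> \<in> space M. exceeds \<iota> n y u \<omega>} \<le> real n * Fbar (e * y) + exp (- (g y / y * u / sqrt e))) at_top"
proof -
  have "filterlim (\<lambda>y::real. e * y) at_top at_top"
    using e by (intro filterlim_tendsto_pos_mult_at_top[OF tendsto_const]) (auto simp: filterlim_ident)
  moreover have "0 < e powr \<gamma>" using e by simp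
  ultimately have "eventually (\<lambda>y. \<forall>(\<iota> :: nat \<Rightarrow> nat) n u. inj \<iota> \<longrightarrow>
     prob {\<omega> \<in> space M. \<exists>j\<le>n. u \<le> (\<Sum>i<j. min (X (\<iota> i) \<omega>) (e * y) + a - e powr \<gamma> * (e * y) powr (-\<gamma>))}
       \<le> exp (- (g (e * y) / (e * y)) * u)) at_top"
    by (rule eventually_compose_filterlim[OF truncated_maximum, rotated])
  then show ?thesis using eventually_gt_at_top[of 0]
  proof eventually_elim
    case (elim y)
    have eq: "e powr \<gamma> * (e * y) powr (-\<gamma>) = y powr (-\<gamma>)"
      using elim e by (simp add: powr_mult powr_minus)
    show ?case
    proof (intro allI impI)
      fix \<iota> :: "nat \<Rightarrow> nat" and n and u :: real assume \<iota>: "inj \<iota>" and u: "0 \<le> u"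
      let ?E = "{\<omega> \<in> space M. \<exists>j\<le>n. u \<le> (\<Sum>i<j. min (X (\<iota> i) \<omega>) (e * y) + a - y powr (-\<gamma>))}"
      let ?J = "{\<omega> \<in> space M. \<exists>i<n. X (\<iota> i) \<omega> > e * y}"
      \<comment> \<open>Without an increment above \<open>e * y\<close> the truncations at
        \<open>y / 2\<close> and at \<open>e * y\<close> agree.\<close>
      have "{\<omega> \<in> space M. exceeds \<iota> n y u \<omega>} \<subseteq> ?J \<union> ?E"
      proof
        fix \<omega> assume \<omega>: "\<omega> \<in> {\<omega> \<in> space M. exceeds \<iota> n y u \<omega>}"
        show "\<omega> \<in> ?J \<union> ?E"
        proof (rule ccontr)
          assume *: "\<omega> \<notin> ?J \<union> ?E"
          then have small: "X (\<iota> i) \<omega> \<le> e * y" if "i < n" for i using \<omega> that by force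
          obtain j where j: "j \<le> n" "u \<le> (\<Sum>i<j. min (X (\<iota> i) \<omega>) (y / 2) + a - y powr (-\<gamma>))"
            using \<omega> by (auto simp: exceeds_def)
          have ey: "e * y \<le> y / 2" using e elim by simp
          have "(\<Sum>i<j. min (X (\<iota> i) \<omega>) (y / 2) + a - y powr (-\<gamma>)) = (\<Sum>i<j. min (X (\<iota> i) \<omega>) (e * y) + a - y powr (-\<gamma>))"
          proof (rule sum.cong)
            fix i assume "i \<in> {..<j}"
            then have "X (\<iota> i) \<omega> \<le> e * y" using small[of i] j by auto
            then show "min (X (\<iota> i) \<omega>) (y / 2) + a - y powr (-\<gamma>) = min (X (\<iota> i) \<omega>) (e * y) + a - y powr (-\<gamma>)"
              using ey by simp
          qed simp
          with j * \<omega> show False by auto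
        qed
      qed
      then have "prob {\<omega> \<in> space M. exceeds \<iota> n y u \<omega>} \<le> prob (?J \<union> ?E)"
        by (intro finite_measure_mono) auto
      also have "\<dots> \<le> prob ?J + prob ?E" by (intro measure_Un_le) auto
      also have "prob ?J \<le> real n * Fbar (e * y)" by (rule prob_ex_X_gt_le)
      also have "prob ?E \<le> exp (- (g (e * y) / (e * y)) * u)"
        using elim \<iota> by (simp only: eq)
      also have "\<dots> \<le> exp (- (g y / y * u / sqrt e))"
      proof -
        have "g y / y / sqrt e * u \<le> g (e * y) / (e * y) * u"
          using e elim u by (intro mult_right_mono g_scale) auto
        then show ?thesis by simp
      qed
      finally show "prob {\<omega> \<in> space M. exceeds \<iota> n y u \<omega>} \<le> real n * Fbar (e * y) + exp (- (g y / y * u / sqrt e))"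
        by simp
    qed
  qed
qed

text \<open>A quadratic horizon is long enough for survival past it to be negligible against
  \<open>G y\<close>, and short enough that the expected number of jumps above any fixed fraction of
  \<open>y\<close> vanishes.\<close>

definition horizon :: "real \<Rightarrow> nat" where
  "horizon y = nat \<lceil>y\<^sup>2\<rceil>"

lemma horizon_ge: "y\<^sup>2 \<le> real (horizon y)" 
  unfolding horizon_def by linarith

lemma horizon_le: "1 \<le> y \<Longrightarrow> real (horizon y) \<le> 2 * y\<^sup>2"
proof -
  assume "1 \<le> y"
  then have "1 \<le> y\<^sup>2" by simp
  then show ?thesis unfolding horizon_def by linarith
qed

text \<open>The quadratic horizon cancels the power in the tail, which leaves a constant times
  \<open>exp (- g (e * y))\<close>.\<close>

lemma eventually_horizon_Fbar:
  assumes e: "0 < e" and \<epsilon>: "\<epsilon> > 0"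
  shows "eventually (\<lambda>y. real (horizon y) * Fbar (e * y) \<le> \<epsilon>) at_top"
proof -
  have ey: "filterlim (\<lambda>y::real. e * y) at_top at_top"
    using e by (intro filterlim_tendsto_pos_mult_at_top[OF tendsto_const]) (auto simp: filterlim_ident)
  have 1: "eventually (\<lambda>y. Fbar (e * y) \<le> (1 + 1) * G (e * y)) at_top"
    by (rule eventually_compose_filterlim[OF eventually_Fbar_le ey]) simp
  have 2: "eventually (\<lambda>y. - ln (\<epsilon> * e\<^sup>2 / 4) \<le> g (e * y)) at_top"
    by (rule eventually_compose_filterlim[OF eventually_g_ge ey])
  show ?thesis using 1 2 eventually_ge_at_top[of 1]
  proof eventually_elim
    case (elim y)
    have "exp (- g (e * y)) \<le> exp (ln (\<epsilon> * e\<^sup>2 / 4))" using elim by simp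
    also have "\<dots> = \<epsilon> * e\<^sup>2 / 4" using e \<epsilon> by simp
    finally have x: "exp (- g (e * y)) \<le> \<epsilon> * e\<^sup>2 / 4" .
    have "real (horizon y) * Fbar (e * y) \<le> (2 * y\<^sup>2) * (2 * G (e * y))"
      using horizon_le[of y] elim by (intro mult_mono Fbar_nonneg) auto
    also have "\<dots> = exp (- g (e * y)) * (4 / e\<^sup>2)"
      using elim e by (simp add: G_def powr_minus powr_numeral power_mult_distrib field_simps)
    also have "\<dots> \<le> (\<epsilon> * e\<^sup>2 / 4) * (4 / e\<^sup>2)" by (intro mult_right_mono x) auto
    also have "\<dots> = \<epsilon>" using e by simp
    finally show ?case .
  qed
qed

text \<open>At level \<open>\<eta> * (y / g y)\<close> the rate \<open>7/5 * (g y / y)\<close>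
  yields only a constant. Truncating at a small multiple of \<open>y\<close> makes the exponent as
  large as desired, at the cost of one jump event of vanishing probability.\<close>

lemma eventually_exceeds_small:
  assumes \<eta>: "\<eta> > 0" and \<epsilon>: "\<epsilon> > 0"
  shows "eventually (\<lambda>y. \<forall>\<iota>. inj \<iota> \<longrightarrow>
      prob {\<omega> \<in> space M. exceeds \<iota> (horizon y) y (\<eta> * (y / g y)) \<omega>} \<le> \<epsilon>) at_top"
proof -
  \<comment> \<open>The truncation fraction \<open>e = 1 / L^2\<close> multiplies the exponent
    \<open>\<eta>\<close> by \<open>L\<close>, bringing the exponential below
    \<open>\<epsilon> / 2\<close>; \<open>L \<ge> 2\<close> keeps \<open>e\<close> below
    1/2.\<close>
  define L where "L = max 2 (- ln (\<epsilon> / 2) / \<eta>)"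
  define e where "e = 1 / L\<^sup>2"
  have L: "L \<ge> 2" "- ln (\<epsilon> / 2) \<le> \<eta> * L" using \<eta> by (auto simp: L_def max_def field_simps)
  have "2\<^sup>2 \<le> L\<^sup>2" using L by (intro power_mono) auto
  then have e: "0 < e" "e \<le> 1/2" unfolding e_def using L by (auto simp: field_simps)
  have se: "sqrt e = 1 / L" using L by (simp add: e_def real_sqrt_divide)
  show ?thesis
    using eventually_exceeds_le_refined[OF e] eventually_horizon_Fbar[OF e(1) half_gt_zero[OF \<epsilon>]] eventually_g_ge[of 1]
      eventually_gt_at_top[of 0]
  proof eventually_elim
    case (elim y)
    show ?case
    proof (intro allI impI)
      fix \<iota> :: "nat \<Rightarrow> nat" assume \<iota>: "inj \<iota>"
      have "prob {\<omega> \<in> space M. exceeds \<iota> (horizon y) y (\<eta> * (y / g y)) \<omega>}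
         \<le> real (horizon y) * Fbar (e * y) + exp (- (g y / y * (\<eta> * (y / g y)) / sqrt e))"
      proof -
        have "0 \<le> \<eta> * (y / g y)" using elim \<eta> by simp
        then show ?thesis using elim(1) \<iota> by blast
      qed
      also have "g y / y * (\<eta> * (y / g y)) / sqrt e = \<eta> * L" using elim by (simp add: se)
      also have "exp (- (\<eta> * L)) \<le> exp (ln (\<epsilon> / 2))" using L by simp
      also have "\<dots> = \<epsilon> / 2" using \<epsilon> by simp
      also have "real (horizon y) * Fbar (e * y) \<le> \<epsilon> / 2" using elim \<epsilon> by simp
      finally show "prob {\<omega> \<in> space M. exceeds \<iota> (horizon y) y (\<eta> * (y / g y)) \<omega>} \<le> \<epsilon>" by simp
    qed
  qed
qed

end

section \<open>Deterministic tools: area under a line, removal of one increment,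
  interpolation\<close>

text \<open>Completing the square removes the dependence on the length \<open>T\<close>. The term
  \<open>b / 2\<close> is the discretization error of the triangle, and the last factor
  \<open>b / a \<le> 1\<close> is discarded.\<close>

lemma sum_drift_le:
  fixes s :: "nat \<Rightarrow> real"
  assumes b: "0 < b" "b \<le> a" and H: "0 \<le> H + b / 2" "H + b / 2 \<le> y * (b / a)" and y: "0 \<le> y"
    and s: "\<And>j. j < T \<Longrightarrow> s j \<le> H - b * real j"
  shows "(\<Sum>j<T. s j) \<le> y\<^sup>2 / (2 * a)"
proof -
  have "(\<Sum>j<T. s j) \<le> (\<Sum>j<T. H - b * real j)" by (intro sum_mono s) auto
  also have "\<dots> = real T * (H + b / 2) - b * (real T)\<^sup>2 / 2"
    by (induction T) (simp_all add: power2_eq_square algebra_simps add_divide_distrib)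
  also have "\<dots> = (H + b / 2)\<^sup>2 / (2 * b) - (H + b / 2 - b * real T)\<^sup>2 / (2 * b)"
  proof -
    have "h\<^sup>2 / (2 * b) - (h - b * t)\<^sup>2 / (2 * b) = t * h - b * t\<^sup>2 / 2" for h t :: real
      using b by (simp add: power2_eq_square field_simps)
    then show ?thesis by simp
  qed
  also have "\<dots> \<le> (H + b / 2)\<^sup>2 / (2 * b)" using b by simp
  also have "\<dots> \<le> (y * (b / a))\<^sup>2 / (2 * b)"
    using H b by (intro divide_right_mono power_mono) auto
  also have "\<dots> = y\<^sup>2 / (2 * a) * (b / a)" using b by (simp add: power2_eq_square field_simps)
  also have "\<dots> \<le> y\<^sup>2 / (2 * a) * 1" using b by (intro mult_left_mono) auto
  finally show ?thesis by simp
qed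

definition skip :: "nat \<Rightarrow> nat \<Rightarrow> nat" where
  "skip k i = (if i < k then i else Suc i)"

lemma inj_skip: "inj (skip k)"
  by (auto simp: inj_def skip_def split: if_splits)

lemma skip_neq: "skip k i \<noteq> k"
  by (auto simp: skip_def)

lemma sum_skip_le: "j \<le> k \<Longrightarrow> (\<Sum>i<j. f (skip k i)) = (\<Sum>i<j. f i :: real)"
  by (intro sum.cong) (auto simp: skip_def)

lemma sum_skip_Suc: "k \<le> m \<Longrightarrow> (\<Sum>i<Suc m. f i :: real) = f k + (\<Sum>i<m. f (skip k i))"
proof (induction m rule: dec_induct)
  case base
  show ?case using sum_skip_le[of k k f] by simp
next
  case (step m)
  have "skip k m = Suc m" using step by (simp add: skip_def)
  then show ?case using step by simp
qed

text \<open>Combines a small bound that does not decay in the level with a decaying bound whose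
  constant is not small; a little weight on the former keeps almost the full decay.\<close>

lemma le_weighted_geometric_mean:
  fixes p A B s :: real
  assumes "0 \<le> p" "p \<le> A" "p \<le> B" "0 < s" "s < 1"
  shows "p \<le> A powr s * B powr (1 - s)"
proof -
  have "p = p powr s * p powr (1 - s)" using assms by (simp add: powr_add[symmetric])
  also have "\<dots> \<le> A powr s * B powr (1 - s)" using assms by (intro mult_mono powr_mono2) auto
  finally show ?thesis .
qed

context area_walk
begin

subsection \<open>Survival probabilities\<close>

text \<open>Stated through partial sums rather than as \<open>k < rw_tau X \<omega>\<close>, since
  the \<open>LEAST\<close> in \<open>rw_tau\<close> is meaningful only for paths that
  return.\<close>

definition alive :: "nat \<Rightarrow> 'a \<Rightarrow> bool" where
  "alive k \<omega> \<longleftrightarrow> (\<forall>j\<in>{1..k}. 0 < rw_S X j \<omega>)"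

definition survival :: "nat \<Rightarrow> real" where
  "survival k = prob {\<omega> \<in> space M. alive k \<omega>}"

lemma rw_S_measurable [measurable]: "rw_S X n \<in> borel_measurable M"
  unfolding rw_S_def[abs_def] by measurable

lemma alive_measurable [measurable]: "Measurable.pred M (alive k)"
  unfolding alive_def by measurable

lemma survival_nonneg: "0 \<le> survival k" and survival_le_1: "survival k \<le> 1"
  by (auto simp: survival_def)

text \<open>If no increment exceeds \<open>z\<close>, a nonnegative partial sum at time
  \<open>n\<close> forces the truncated walk with restored drift up to
  \<open>n * (a / 2)\<close>.\<close>

lemma eventually_survival_le:
  "eventually (\<lambda>z. \<forall>n. survival n \<le> real n * Fbar z + exp (- (g z / z) * (real n * (a / 2)))) at_top"
proof -
  have "((\<lambda>z::real. z powr (-\<gamma>)) \<longlongrightarrow> 0) at_top"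
    using \<gamma> by (intro tendsto_neg_powr filterlim_ident) auto
  then have "eventually (\<lambda>z::real. z powr (-\<gamma>) < a / 2) at_top"
    using a_pos by (intro order_tendstoD) auto
  with truncated_maximum[OF zero_less_one] show ?thesis
  proof eventually_elim
    case (elim z)
    show ?case
    proof
      fix n
      let ?J = "{\<omega> \<in> space M. \<exists>i<n. X (id i) \<omega> > z}"
      let ?E = "{\<omega> \<in> space M. \<exists>j\<le>n. real n * (a / 2) \<le> (\<Sum>i<j. min (X (id i) \<omega>) z + a - 1 * z powr (-\<gamma>))}"
      have "{\<omega> \<in> space M. alive n \<omega>} \<subseteq> ?J \<union> ?E"
      proof (rule subsetI, rule UnCI)
        fix \<omega> assume "\<omega> \<in> {\<omega> \<in> space M. alive n \<omega>}" "\<omega> \<notin> ?E"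
        then have \<omega>: "\<omega> \<in> space M" "alive n \<omega>" and nE: "\<omega> \<notin> ?E" by auto
        show "\<omega> \<in> ?J"
        proof (rule ccontr)
          assume nJ: "\<omega> \<notin> ?J"
          have S: "0 \<le> rw_S X n \<omega>" using \<omega>(2) by (cases "n = 0") (auto simp: alive_def rw_S_def less_imp_le)
          have "real n * (a / 2) \<le> real n * (a - z powr (-\<gamma>))"
            using elim by (intro mult_left_mono) auto
          also have "\<dots> \<le> (\<Sum>i<n. X i \<omega>) + real n * (a - z powr (-\<gamma>))"
            using S by (simp add: rw_S_def)
          also have "\<dots> = (\<Sum>i<n. X i \<omega> + (a - z powr (-\<gamma>)))" by (simp add: sum.distrib)
          also have "\<dots> = (\<Sum>i<n. min (X i \<omega>) z + a - 1 * z powr (-\<gamma>))"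
          proof (rule sum.cong)
            fix i assume "i \<in> {..<n}"
            then have "\<not> z < X i \<omega>" using \<omega>(1) nJ by (simp only: id_apply mem_Collect_eq lessThan_iff) blast
            then show "X i \<omega> + (a - z powr (-\<gamma>)) = min (X i \<omega>) z + a - 1 * z powr (-\<gamma>)" by simp
          qed simp
          finally show False using nE \<omega>(1) by auto
        qed
      qed
      then have "survival n \<le> prob (?J \<union> ?E)"
        unfolding survival_def by (intro finite_measure_mono) auto
      also have "\<dots> \<le> prob ?J + prob ?E" by (intro measure_Un_le) auto
      also have "prob ?J \<le> real n * Fbar z" by (rule prob_ex_X_gt_le)
      also have "prob ?E \<le> exp (- (g z / z) * (real n * (a / 2)))"
        using elim(1) inj_on_id by blast
      finally show "survival n \<le> real n * Fbar z + exp (- (g z / z) * (real n * (a / 2)))" by simp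
    qed
  qed
qed

lemma eventually_survival_le_exp:
  "eventually (\<lambda>n. survival n \<le> (8 / a + 1) * exp (- g (a * real n / 4))) sequentially"
proof -
  have lim: "filterlim (\<lambda>n. a / 4 * real n) at_top sequentially"
    using a_pos by (intro filterlim_tendsto_pos_mult_at_top[OF tendsto_const] filterlim_real_sequentially) auto
  have F2: "eventually (\<lambda>z. Fbar z \<le> (1 + 1) * G z) at_top" by (rule eventually_Fbar_le) simp
  have "eventually (\<lambda>z. (\<forall>n. survival n \<le> real n * Fbar z + exp (- (g z / z) * (real n * (a / 2))))
      \<and> Fbar z \<le> (1 + 1) * G z \<and> 1 \<le> z) at_top"
    by (intro eventually_conj eventually_survival_le F2 eventually_ge_at_top)
  from eventually_compose_filterlim[OF this lim] show ?thesis
  proof eventually_elim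
    case (elim n)
    \<comment> \<open>At this scale the exponential term has exponent \<open>2 * g z\<close>, and
      \<open>n * z powr (-2)\<close> is bounded, so both terms are of order
      \<open>exp (- g z)\<close>.\<close>
    define z where "z = a / 4 * real n"
    have z: "1 \<le> z" "Fbar z \<le> 2 * G z" "survival n \<le> real n * Fbar z + exp (- (g z / z) * (real n * (a / 2)))"
      using elim unfolding z_def[symmetric] by auto
    have n: "real n = 4 / a * z" using a_pos by (simp add: z_def)
    have "g z / z * (real n * (a / 2)) = 2 * g z" using z a_pos by (simp add: n)
    then have "exp (- (g z / z) * (real n * (a / 2))) = exp (- (2 * g z))" by simp
    also have "\<dots> \<le> exp (- g z)" using g_nonneg[of z] z by simp
    finally have 1: "exp (- (g z / z) * (real n * (a / 2))) \<le> exp (- g z)" .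
    have "real n * Fbar z \<le> real n * (2 * G z)" using z by (intro mult_left_mono) auto
    also have "\<dots> = 8 / a * exp (- g z) * (z * z powr (-2))" by (simp add: n G_def)
    also have "z * z powr (-2) = 1 / z" using z by (simp add: powr_minus powr_numeral power2_eq_square field_simps)
    also have "8 / a * exp (- g z) * (1 / z) \<le> 8 / a * exp (- g z) * 1"
      using z a_pos by (intro mult_left_mono) auto
    finally have "real n * Fbar z \<le> 8 / a * exp (- g z)" by simp
    with 1 z(3) have "survival n \<le> 8 / a * exp (- g z) + exp (- g z)" by linarith
    then have "survival n \<le> (8 / a + 1) * exp (- g z)" by (simp add: distrib_right)
    then show ?case by (simp add: z_def mult.commute)
  qed
qed

text \<open>Growth beyond \<open>4 * ln\<close> makes survival of order \<open>n^(-4)\<close>, and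
  the square root is still summable. This root is the weight left by the geometric mean.\<close>

lemma summable_sqrt_survival: "summable (\<lambda>n. sqrt (survival n))"
proof -
  define K where "K = sqrt (8 / a + 1) * (16 / a\<^sup>2)"
  have lim: "filterlim (\<lambda>n. a / 4 * real n) at_top sequentially"
    using a_pos by (intro filterlim_tendsto_pos_mult_at_top[OF tendsto_const] filterlim_real_sequentially) auto
  have "eventually (\<lambda>z. 0 \<le> g z - 4 * ln z) at_top"
    using g_superlog[of 4] unfolding filterlim_at_top by blast
  then have "eventually (\<lambda>z. 0 \<le> g z - 4 * ln z \<and> 0 < z) at_top"
    by (intro eventually_conj eventually_gt_at_top)
  from eventually_compose_filterlim[OF this lim] eventually_survival_le_exp eventually_gt_at_top[of 0]
  have "eventually (\<lambda>n. norm (sqrt (survival n)) \<le> K * inverse (real n ^ 2)) sequentially"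
  proof eventually_elim
    case (elim n)
    define z where "z = a / 4 * real n"
    have z: "0 < z" "4 * ln z \<le> g z" using elim by (auto simp: z_def)
    have "exp (- g z) \<le> exp (- (4 * ln z))" using z by simp
    also have "\<dots> = (1 / z ^ 2) ^ 2"
      using z by (simp add: exp_minus exp_of_nat_mult[of 4 "ln z", simplified] power_divide inverse_eq_divide flip: power_mult)
    finally have e: "exp (- g z) \<le> (1 / z ^ 2) ^ 2" .
    have "sqrt (survival n) \<le> sqrt ((8 / a + 1) * exp (- g z))"
      using elim by (intro real_sqrt_le_mono) (simp add: z_def mult.commute)
    also have "\<dots> \<le> sqrt ((8 / a + 1) * (1 / z ^ 2) ^ 2)"
      using e a_pos by (intro real_sqrt_le_mono mult_left_mono) auto
    also have "\<dots> = sqrt (8 / a + 1) * (1 / z ^ 2)" by (simp add: real_sqrt_mult)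
    also have "\<dots> = K * inverse (real n ^ 2)"
      using a_pos elim by (simp add: K_def z_def power_mult_distrib power_divide field_simps)
    finally show ?case using survival_nonneg by simp
  qed
  then show ?thesis
    by (rule summable_comparison_test_ev) (intro summable_mult inverse_power_summable, simp)
qed

lemma summable_survival: "summable survival"
proof (rule summable_comparison_test[OF _ summable_sqrt_survival])
  have "survival n \<le> sqrt (survival n)" for n
    using survival_nonneg[of n] survival_le_1[of n]
    by (intro real_le_rsqrt) (simp add: power2_eq_square mult_left_le)
  then show "\<exists>N. \<forall>n\<ge>N. norm (survival n) \<le> sqrt (survival n)" using survival_nonneg by auto
qed

text \<open>After \<open>y^2\<close> steps the argument \<open>t\<close> of \<open>g\<close> is at
  least \<open>sqrt y * y\<close>. Growth with constant 6 over the ratio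
  \<open>t / y \<ge> sqrt y\<close> gains \<open>y powr (-3)\<close>, one power more than
  \<open>G y\<close> contains.\<close>

lemma eventually_survival_horizon:
  assumes \<epsilon>: "\<epsilon> > 0"
  shows "eventually (\<lambda>y. survival (horizon y) \<le> \<epsilon> * G y) at_top"
proof -
  have hor: "filterlim horizon at_top at_top"
    unfolding filterlim_at_top
  proof
    fix Z :: nat
    show "eventually (\<lambda>y. Z \<le> horizon y) at_top"
      using eventually_ge_at_top[of "real Z"] eventually_ge_at_top[of 1]
    proof eventually_elim
      case (elim y)
      have "real Z \<le> y * 1" using elim by simp
      also have "\<dots> \<le> y * y" using elim by (intro mult_left_mono) auto
      also have "\<dots> \<le> real (horizon y)" using horizon_ge[of y] by (simp add: power2_eq_square)
      finally show ?case by simp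
    qed
  qed
  obtain t0 where t0: "t0 > 0" "\<And>s t. t0 \<le> s \<Longrightarrow> s \<le> t \<Longrightarrow> 6 * ln (t / s) \<le> g t - g s"
    using g_growth[of 6] by auto
  define K where "K = 8 / a + 1"
  have K: "K > 0" using a_pos by (simp add: K_def add_pos_pos)
  have sq: "filterlim (\<lambda>y::real. sqrt y) at_top at_top" by (rule sqrt_at_top)
  have "eventually (\<lambda>y. 4 / a \<le> sqrt y) at_top" using sq by (simp add: filterlim_at_top)
  with eventually_compose_filterlim[OF eventually_survival_le_exp hor] eventually_ge_at_top[of t0]
    eventually_ge_at_top[of 1] eventually_ge_at_top[of "K / \<epsilon>"]
  show ?thesis
  proof eventually_elim
    case (elim y)
    define t where "t = a * real (horizon y) / 4"
    have "1 * (sqrt y * y) \<le> (a / 4 * sqrt y) * (sqrt y * y)"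
      using elim a_pos by (intro mult_right_mono) (auto simp: field_simps)
    also have "\<dots> = a * y\<^sup>2 / 4" using elim by (simp add: power2_eq_square field_simps)
    also have "\<dots> \<le> t" unfolding t_def using horizon_ge[of y] a_pos by (intro divide_right_mono mult_left_mono) auto
    finally have ty: "sqrt y \<le> t / y" using elim by (simp add: field_simps)
    have "1 * y \<le> sqrt y * y" using elim by (intro mult_right_mono) auto
    also have "\<dots> \<le> t" using ty elim by (simp add: field_simps)
    finally have yt: "y \<le> t" by simp
    have "3 * ln y = 6 * ln (sqrt y)" using elim by (simp add: ln_sqrt)
    also have "\<dots> \<le> 6 * ln (t / y)" using ty elim yt by (intro mult_left_mono ln_mono) auto
    also have "\<dots> \<le> g t - g y" using elim yt by (intro t0) auto
    finally have "exp (- g t) \<le> exp (- g y + (-3) * ln y)" by simp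
    also have "\<dots> = exp (- g y) * y powr (-3)" using elim unfolding exp_add by (simp add: powr_def)
    also have "y powr (-3) = y powr (-2) / y"
      using elim by (simp add: powr_minus powr_numeral power2_eq_square power3_eq_cube field_simps)
    finally have "exp (- g t) \<le> G y / y" by (simp add: G_def)
    then have "K * exp (- g t) \<le> K * (G y / y)" using K by (intro mult_left_mono) auto
    also have "\<dots> = (K / y) * G y" by simp
    also have "\<dots> \<le> \<epsilon> * G y" using elim \<epsilon> by (intro mult_right_mono G_nonneg) (auto simp: field_simps)
    finally show ?case using elim by (simp add: K_def t_def)
  qed
qed

section \<open>Excursions with two large jumps\<close>

lemma prob_two_jumps_le:
  "prob {\<omega> \<in> space M. \<exists>i<n. \<exists>j<n. i \<noteq> j \<and> X i \<omega> > t \<and> X j \<omega> > t} \<le> (real n * Fbar t)\<^sup>2"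
proof -
  let ?A = "\<lambda>p. {\<omega> \<in> space M. fst p \<noteq> snd p \<and> X (fst p) \<omega> > t \<and> X (snd p) \<omega> > t}"
  have "{\<omega> \<in> space M. \<exists>i<n. \<exists>j<n. i \<noteq> j \<and> X i \<omega> > t \<and> X j \<omega> > t} = (\<Union>p\<in>{..<n} \<times> {..<n}. ?A p)"
    by auto blast
  then have "prob {\<omega> \<in> space M. \<exists>i<n. \<exists>j<n. i \<noteq> j \<and> X i \<omega> > t \<and> X j \<omega> > t}
      \<le> (\<Sum>p\<in>{..<n} \<times> {..<n}. prob (?A p))"
    by (simp only:) (rule finite_measure_subadditive_finite, auto)
  also have "\<dots> \<le> (\<Sum>p\<in>{..<n} \<times> {..<n}. Fbar t * Fbar t)"
  proof (rule sum_mono)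
    fix p :: "nat \<times> nat"
    show "prob (?A p) \<le> Fbar t * Fbar t"
    proof (cases "fst p = snd p")
      case True
      then show ?thesis by (simp add: Fbar_nonneg)
    next
      case False
      have "prob {\<omega> \<in> space M. t < X (fst p) \<omega> \<and> t < X (snd p) \<omega>}
         = prob {\<omega> \<in> space M. t < X (fst p) \<omega>} * prob {\<omega> \<in> space M. t < X (snd p) \<omega>}"
        by (rule prob_disjoint_coords[OF indep, where A="{fst p}" and B="{snd p}"
              and P="\<lambda>f. t < f (fst p)" and Q="\<lambda>f. t < f (snd p)"]) (use False in auto)
      then show ?thesis using False by (simp add: prob_X_gt)
    qed
  qed
  also have "\<dots> = (real n * Fbar t)\<^sup>2" by (simp add: power2_eq_square)
  finally show ?thesis .
qed

lemma eventually_two_jumps: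
  assumes \<epsilon>: "\<epsilon> > 0"
  shows "eventually (\<lambda>y. prob {\<omega> \<in> space M. \<exists>i<horizon y. \<exists>j<horizon y. i \<noteq> j \<and> X i \<omega> > y / 2 \<and> X j \<omega> > y / 2}
     \<le> \<epsilon> * G y) at_top"
proof -
  have half: "filterlim (\<lambda>y::real. y / 2) at_top at_top"
    using filterlim_tendsto_pos_mult_at_top[OF tendsto_const[of "1/2 :: real"] _ filterlim_ident] by simp
  have F2: "eventually (\<lambda>z. Fbar z \<le> (1 + 1) * G z) at_top" by (rule eventually_Fbar_le) simp
  \<comment> \<open>Squaring \<open>exp (- (7/10 * g y))\<close> leaves the surplus 2/5, and 256 is
    the square of 16: 2 from the horizon, 2 from the tail, 4 from
    \<open>(y / 2) powr (-2)\<close>.\<close>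
  have E: "eventually (\<lambda>y. exp (- (1 + 2/5) * g y) \<le> \<epsilon> / 256 * G y) at_top"
    using \<epsilon> by (intro eventually_exp_le_G) auto
  from eventually_compose_filterlim[OF F2 half] E eventually_ge_at_top[of 1] show ?thesis
  proof eventually_elim
    case (elim y)
    have "real (horizon y) * Fbar (y / 2) \<le> (2 * y\<^sup>2) * (2 * G (y / 2))"
      using horizon_le[of y] elim by (intro mult_mono Fbar_nonneg) auto
    also have "\<dots> = 16 * exp (- g (y / 2))"
      using elim by (simp add: G_def powr_minus powr_numeral power_divide field_simps)
    also have "\<dots> \<le> 16 * exp (- (7/10 * g y))" using g_half[of y] elim by simp
    finally have "(real (horizon y) * Fbar (y / 2))\<^sup>2 \<le> (16 * exp (- (7/10 * g y)))\<^sup>2"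
      by (intro power_mono mult_nonneg_nonneg Fbar_nonneg) auto
    also have "\<dots> = 256 * exp (- (1 + 2/5) * g y)"
      by (simp add: power_mult_distrib exp_double[symmetric] power2_eq_square exp_add[symmetric])
    also have "\<dots> \<le> 256 * (\<epsilon> / 256 * G y)" using elim by (intro mult_left_mono) auto
    finally show ?case using prob_two_jumps_le[of "horizon y" "y / 2"] by simp
  qed
qed


subsection \<open>Upper bound\<close>

text \<open>With \<open>b = a - y powr (-\<gamma>)\<close> this is
  \<open>y * (b / a) - 2 * a\<close>: the height of a line of slope \<open>-b\<close> with area at
  most \<open>y^2 / (2 * a)\<close>, less room for the half step of discretization and for one
  further step \<open>b\<close>.\<close>

definition threshold :: "real \<Rightarrow> real" where
  "threshold y = y - y powr (1 - \<gamma>) / a - 2 * a"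

text \<open>The hypothesis supplies the witness that gives \<open>LEAST\<close> its meaning; from
  then on \<open>alive\<close> and \<open>rw_tau\<close> are interchangeable.\<close>

lemma rw_tau_le:
  assumes "\<not> alive n \<omega>"
  shows "rw_tau X \<omega> \<le> n" "alive k \<omega> \<longleftrightarrow> k < rw_tau X \<omega>"
proof -
  let ?P = "\<lambda>n. n \<ge> 1 \<and> rw_S X n \<omega> \<le> 0"
  obtain m where m: "?P m" "m \<le> n" using assms by (auto simp: alive_def not_less)
  then show "rw_tau X \<omega> \<le> n" unfolding rw_tau_def using Least_le[of ?P m] by linarith
  have P: "?P (rw_tau X \<omega>)" unfolding rw_tau_def using m(1) by (rule LeastI)
  show "alive k \<omega> \<longleftrightarrow> k < rw_tau X \<omega>"
  proof
    assume "alive k \<omega>"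
    then show "k < rw_tau X \<omega>" using P unfolding alive_def by (meson atLeastAtMost_iff leI not_less)
  next
    assume k: "k < rw_tau X \<omega>"
    have "\<not> ?P j" if "j < rw_tau X \<omega>" for j
      using that unfolding rw_tau_def by (rule not_less_Least)
    then have "0 < rw_S X j \<omega>" if "1 \<le> j" "j \<le> k" for j using k that by (meson le_less_trans not_le)
    then show "alive k \<omega>" by (simp add: alive_def)
  qed
qed

text \<open>A walk staying below a line of slope \<open>-b\<close> has area at most that of the triangle under the line.\<close>

lemma area_large_cases:
  assumes y: "0 < y" "y powr (-\<gamma>) < a" "0 \<le> threshold y"
    and A: "y\<^sup>2 / (2 * a) < rw_area X \<omega>" and na: "\<not> alive n \<omega>"
    and one: "\<not> (\<exists>i<n. \<exists>j<n. i \<noteq> j \<and> X i \<omega> > y / 2 \<and> X j \<omega> > y / 2)"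
    and ne: "\<not> exceeds id n y (threshold y) \<omega>"
  shows "\<exists>k<n. alive k \<omega> \<and> X k \<omega> > y / 2 \<and> exceeds (skip k) n y (threshold y - X k \<omega>) \<omega>"
proof -
  define b where "b = a - y powr (-\<gamma>)"
  define T where "T = rw_tau X \<omega>"
  note tau = rw_tau_le[OF na]
  have Tn: "T \<le> n" using tau by (simp add: T_def)
  have b: "0 < b" "b \<le> a" using y by (auto simp: b_def)
  have yb: "y * (b / a) = y - y powr (1 - \<gamma>) / a"
  proof -
    have "y powr (1 - \<gamma>) = y * y powr (-\<gamma>)" using y by (simp add: powr_diff powr_minus field_simps)
    then show ?thesis using a_pos by (simp add: b_def field_simps)
  qed
  have thr: "threshold y + b + b / 2 \<le> y * (b / a)" "threshold y + b / 2 \<le> y * (b / a)"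
    using b unfolding yb threshold_def by auto
  \<comment> \<open>Contrapositive of the drift bound: the area is too large for a line of
    admissible height to dominate the whole excursion.\<close>
  have area: "\<not> (\<forall>j<T. rw_S X j \<omega> \<le> H - b * real j)"
    if "0 \<le> H + b / 2" "H + b / 2 \<le> y * (b / a)" for H
    using sum_drift_le[OF b that less_imp_le[OF y(1)], of T "\<lambda>j. rw_S X j \<omega>"] A
    unfolding rw_area_def T_def[symmetric] by force
  have split: "(\<Sum>i<j. f i + a - y powr (-\<gamma>)) = (\<Sum>i<j. f i) + b * real j" for f :: "nat \<Rightarrow> real" and j
    by (simp add: b_def sum.distrib sum_subtractf algebra_simps)
  have "\<exists>k<T. X k \<omega> > y / 2"
  proof (rule ccontr)
    assume "\<not> (\<exists>k<T. X k \<omega> > y / 2)"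
    then have small: "\<And>i. i < T \<Longrightarrow> X i \<omega> \<le> y / 2" by (meson not_less)
    have "rw_S X j \<omega> \<le> threshold y - b * real j" if j: "j < T" for j
    proof -
      have "\<not> threshold y \<le> (\<Sum>i<j. min (X (id i) \<omega>) (y / 2) + a - y powr (-\<gamma>))"
        using ne j Tn unfolding exceeds_def by auto
      moreover have "(\<Sum>i<j. min (X (id i) \<omega>) (y / 2)) = rw_S X j \<omega>"
        unfolding rw_S_def using small j by (intro sum.cong) (auto simp: min_def)
      ultimately show ?thesis unfolding split by simp
    qed
    then show False using area[of "threshold y"] thr y b by auto
  qed
  then obtain k where k: "k < T" "X k \<omega> > y / 2" by blast
  have small: "X i \<omega> \<le> y / 2" if "i < n" "i \<noteq> k" for i
    using one that k Tn by (metis less_le_trans not_le)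
  have "exceeds (skip k) n y (threshold y - X k \<omega>) \<omega>"
  proof (rule ccontr)
    assume nx: "\<not> exceeds (skip k) n y (threshold y - X k \<omega>) \<omega>"
    have W: "(\<Sum>i<j. X (skip k i) \<omega>) + b * real j < threshold y - X k \<omega>" if j: "j < n" for j
    proof -
      have "\<not> threshold y - X k \<omega> \<le> (\<Sum>i<j. min (X (skip k i) \<omega>) (y / 2) + a - y powr (-\<gamma>))"
        using nx j unfolding exceeds_def by auto
      moreover have "(\<Sum>i<j. min (X (skip k i) \<omega>) (y / 2)) = (\<Sum>i<j. X (skip k i) \<omega>)"
      proof (rule sum.cong)
        fix i assume "i \<in> {..<j}"
        then have "skip k i < n" using j by (auto simp: skip_def)
        then have "X (skip k i) \<omega> \<le> y / 2" using small skip_neq by blast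
        then show "min (X (skip k i) \<omega>) (y / 2) = X (skip k i) \<omega>" by simp
      qed simp
      ultimately show ?thesis unfolding split by simp
    qed
    \<comment> \<open>After the jump, \<open>j\<close> increments contain only \<open>j - 1\<close>
      of the walk without \<open>X k\<close>, so the line is raised by one step \<open>b\<close>.
      Before it, the positive \<open>X k\<close> is dropped from the bound.\<close>
    have "rw_S X j \<omega> \<le> (threshold y + b) - b * real j" if j: "j < T" for j
    proof (cases "j \<le> k")
      case True
      have "rw_S X j \<omega> = (\<Sum>i<j. X (skip k i) \<omega>)"
        unfolding rw_S_def using True by (rule sum_skip_le[symmetric])
      then show ?thesis using W[of j] j Tn k(2) y(1) b by simp
    next
      case False
      then obtain m where m: "j = Suc m" "k \<le> m" by (metis less_Suc_eq_le not_le old.nat.exhaust zero_le)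
      have "rw_S X j \<omega> = X k \<omega> + (\<Sum>i<m. X (skip k i) \<omega>)"
        unfolding rw_S_def m(1) by (rule sum_skip_Suc[OF m(2)])
      then show ?thesis using W[of m] j Tn m by (simp add: algebra_simps)
    qed
    then show False using area[of "threshold y + b"] thr y b by auto
  qed
  moreover have "alive k \<omega>" "k < n" using k(1) Tn tau(2)[of k] by (auto simp: T_def)
  ultimately show ?thesis using k(2) by blast
qed

lemma rw_tau_measurable [measurable]: "rw_tau X \<in> measurable M (count_space UNIV)"
  unfolding rw_tau_def[abs_def] by measurable

lemma rw_area_measurable [measurable]: "rw_area X \<in> borel_measurable M"
proof -
  have "(\<lambda>\<omega>. (\<lambda>n \<omega>. \<Sum>k<n. rw_S X k \<omega>) (rw_tau X \<omega>) \<omega>) \<in> borel_measurable M"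
    by (rule measurable_compose_countable) measurable
  then show ?thesis unfolding rw_area_def[abs_def] by simp
qed

lemma prob_alive_jump: "prob {\<omega> \<in> space M. alive k \<omega> \<and> t < X k \<omega>} = survival k * Fbar t"
proof -
  have "prob {\<omega> \<in> space M. (\<lambda>f. \<forall>j\<in>{1..k}. 0 < (\<Sum>i<j. f i)) (\<lambda>i. X i \<omega>) \<and> (\<lambda>f. t < f k) (\<lambda>i. X i \<omega>)}
     = prob {\<omega> \<in> space M. (\<lambda>f. \<forall>j\<in>{1..k}. 0 < (\<Sum>i<j. f i)) (\<lambda>i. X i \<omega>)} * prob {\<omega> \<in> space M. (\<lambda>f. t < f k) (\<lambda>i. X i \<omega>)}"
  proof (rule prob_disjoint_coords[OF indep, where A="{..<k}" and B="{k}"])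
    fix f h :: "nat \<Rightarrow> real" assume "\<And>i. i \<in> {..<k} \<Longrightarrow> f i = h i"
    then have "(\<Sum>i<j. f i) = (\<Sum>i<j. h i)" if "j \<le> k" for j using that by (intro sum.cong) auto
    then show "(\<forall>j\<in>{1..k}. 0 < (\<Sum>i<j. f i)) = (\<forall>j\<in>{1..k}. 0 < (\<Sum>i<j. h i))" by auto
  qed auto
  then show ?thesis by (simp add: alive_def rw_S_def survival_def prob_X_gt)
qed

text \<open>\<open>X k\<close> is independent of all other increments and factors out exactly; the
  two events left share increments and are separated by the geometric mean.\<close>

lemma prob_alive_jump_exceeds:
  "prob {\<omega> \<in> space M. (alive k \<omega> \<and> exceeds (skip k) n y u \<omega>) \<and> t < X k \<omega>}
     \<le> sqrt (survival k) * sqrt (prob {\<omega> \<in> space M. exceeds (skip k) n y u \<omega>}) * Fbar t"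
proof -
  let ?P = "\<lambda>f. (\<forall>j\<in>{1..k}. 0 < (\<Sum>i<j. f i)) \<and> (\<exists>j\<le>n. u \<le> (\<Sum>i<j. min (f (skip k i)) (y / 2) + a - y powr (-\<gamma>)))"
  have "prob {\<omega> \<in> space M. ?P (\<lambda>i. X i \<omega>) \<and> (\<lambda>f. t < f k) (\<lambda>i. X i \<omega>)}
     = prob {\<omega> \<in> space M. ?P (\<lambda>i. X i \<omega>)} * prob {\<omega> \<in> space M. (\<lambda>f. t < f k) (\<lambda>i. X i \<omega>)}"
  proof (rule prob_disjoint_coords[OF indep, where A="UNIV - {k}" and B="{k}"])
    fix f h :: "nat \<Rightarrow> real" assume *: "\<And>i. i \<in> UNIV - {k} \<Longrightarrow> f i = h i"
    have "(\<Sum>i<j. f i) = (\<Sum>i<j. h i)" if "j \<le> k" for j using that * by (intro sum.cong) auto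
    moreover have "f (skip k i) = h (skip k i)" for i using * skip_neq[of k i] by auto
    ultimately show "?P f = ?P h" by auto
  qed auto
  then have "prob {\<omega> \<in> space M. (alive k \<omega> \<and> exceeds (skip k) n y u \<omega>) \<and> t < X k \<omega>}
     = prob {\<omega> \<in> space M. alive k \<omega> \<and> exceeds (skip k) n y u \<omega>} * Fbar t"
    by (simp add: alive_def rw_S_def exceeds_def prob_X_gt)
  also have "\<dots> = prob ({\<omega> \<in> space M. alive k \<omega>} \<inter> {\<omega> \<in> space M. exceeds (skip k) n y u \<omega>}) * Fbar t"
    by (simp add: Int_def conj_ac cong: conj_cong)
  also have "\<dots> \<le> sqrt (survival k) * sqrt (prob {\<omega> \<in> space M. exceeds (skip k) n y u \<omega>}) * Fbar t"
    unfolding survival_def by (intro mult_right_mono prob_le_geometric_mean Fbar_nonneg) auto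
  finally show ?thesis .
qed

text \<open>The range of the jump \<open>X k\<close> below \<open>h\<close> is cut into slices of width \<open>w\<close>.\<close>

lemma prob_one_jump_le:
  assumes w: "w > 0"
  shows "prob {\<omega> \<in> space M. alive k \<omega> \<and> X k \<omega> > y / 2 \<and> exceeds (skip k) n y (h - X k \<omega>) \<omega>}
    \<le> survival k * Fbar (h - w)
      + (\<Sum>m\<in>{1..nat \<lfloor>(h - y / 2) / w\<rfloor>}. sqrt (survival k)
           * sqrt (prob {\<omega> \<in> space M. exceeds (skip k) n y (real m * w) \<omega>})
           * Fbar (max (y / 2) (h - (real m + 1) * w)))"
proof -
  let ?L = "nat \<lfloor>(h - y / 2) / w\<rfloor>"
  let ?B = "{\<omega> \<in> space M. alive k \<omega> \<and> h - w < X k \<omega>}"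
  let ?C = "\<lambda>m. {\<omega> \<in> space M. (alive k \<omega> \<and> exceeds (skip k) n y (real m * w) \<omega>) \<and> max (y / 2) (h - (real m + 1) * w) < X k \<omega>}"
  let ?D = "{\<omega> \<in> space M. alive k \<omega> \<and> X k \<omega> > y / 2 \<and> exceeds (skip k) n y (h - X k \<omega>) \<omega>}"
  have "?D \<subseteq> ?B \<union> (\<Union>m\<in>{1..?L}. ?C m)"
  proof
    fix \<omega> assume \<omega>: "\<omega> \<in> ?D"
    show "\<omega> \<in> ?B \<union> (\<Union>m\<in>{1..?L}. ?C m)"
    proof (cases "h - w < X k \<omega>")
      case True
      then show ?thesis using \<omega> by auto
    next
      case False
      define v where "v = (h - X k \<omega>) / w"
      have v: "1 \<le> v" "v \<le> (h - y / 2) / w" using False \<omega> w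
        by (auto simp: v_def field_simps intro: divide_right_mono)
      \<comment> \<open>On slice \<open>m\<close> the remaining walk must reach at least
        \<open>m * w\<close>, while the jump still exceeds \<open>h - (m + 1) * w\<close>. Slice 0
        is the first term, where the exceedance is ignored.\<close>
      define m where "m = nat \<lfloor>v\<rfloor>"
      have rm: "real m = of_int \<lfloor>v\<rfloor>" using v by (simp add: m_def)
      have "real m \<le> v" "v < real m + 1" unfolding rm by linarith+
      then have m: "real m * w \<le> h - X k \<omega>" "h - (real m + 1) * w < X k \<omega>"
        using w by (auto simp: v_def field_simps)
      have "1 \<le> \<lfloor>v\<rfloor>" using v by (simp add: one_le_floor)
      then have "1 \<le> m" by (simp add: m_def le_nat_iff)
      moreover have "m \<le> ?L" unfolding m_def using v by (intro nat_mono floor_mono)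
      moreover have "exceeds (skip k) n y (real m * w) \<omega>" using \<omega> m(1) by (auto intro: exceeds_mono)
      ultimately show ?thesis using \<omega> m(2) by auto
    qed
  qed
  then have "prob ?D \<le> prob (?B \<union> (\<Union>m\<in>{1..?L}. ?C m))" by (intro finite_measure_mono) auto
  also have "\<dots> \<le> prob ?B + prob (\<Union>m\<in>{1..?L}. ?C m)" by (intro measure_Un_le) auto
  also have "prob (\<Union>m\<in>{1..?L}. ?C m) \<le> (\<Sum>m\<in>{1..?L}. prob (?C m))"
    by (intro finite_measure_subadditive_finite) auto
  also have "\<dots> \<le> (\<Sum>m\<in>{1..?L}. sqrt (survival k)
           * sqrt (prob {\<omega> \<in> space M. exceeds (skip k) n y (real m * w) \<omega>})
           * Fbar (max (y / 2) (h - (real m + 1) * w)))"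
    by (intro sum_mono prob_alive_jump_exceeds)
  finally show ?thesis by (simp add: prob_alive_jump)
qed

text \<open>The height lost to the drift slack is \<open>y powr (1 - \<gamma>) / a\<close>; it is
  negligible on the scale \<open>y / g y\<close> precisely because \<open>g y\<close> is small
  compared with \<open>y powr \<gamma>\<close>.\<close>

lemma threshold_gap_lim: "((\<lambda>y. (y - threshold y) * (g y / y)) \<longlongrightarrow> 0) at_top"
proof -
  have "((\<lambda>y. (g y * y powr (-\<gamma>)) * (1 / a) + (2 * a) * (g y / y)) \<longlongrightarrow> 0 * (1 / a) + (2 * a) * 0) at_top"
    by (intro tendsto_intros g_powr_lim g_div_lim)
  moreover have "eventually (\<lambda>y. (g y * y powr (-\<gamma>)) * (1 / a) + (2 * a) * (g y / y) = (y - threshold y) * (g y / y)) at_top"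
    using eventually_gt_at_top[of 0]
  proof eventually_elim
    case (elim y)
    then show ?case using a_pos by (simp add: threshold_def powr_diff powr_minus field_simps)
  qed
  ultimately have "((\<lambda>y. (y - threshold y) * (g y / y)) \<longlongrightarrow> 0 * (1 / a) + (2 * a) * 0) at_top"
    by (rule Lim_transform_eventually)
  then show ?thesis by simp
qed

lemma eventually_threshold_gap:
  assumes "\<eta> > 0"
  shows "eventually (\<lambda>y. y - threshold y \<le> \<eta> * (y / g y)) at_top"
proof -
  have "eventually (\<lambda>y. (y - threshold y) * (g y / y) < \<eta>) at_top"
    using assms by (intro order_tendstoD(2)[OF threshold_gap_lim]) auto
  with eventually_gt_at_top[of 0] eventually_g_ge[of 1] show ?thesis
  proof eventually_elim
    case (elim y)
    then show ?case by (simp add: field_simps)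
  qed
qed

text \<open>With slices of width \<open>\<eta> * (y / g y)\<close>, slice 0 carries the main term.
  In the others the decay of the maximum beats the growth of the tail, so they sum geometrically,
  with a prefactor made small by \<open>eventually_exceeds_small\<close>.\<close>

lemma eventually_one_jump:
  assumes \<eta>: "0 < \<eta>" "\<eta> \<le> 1" and \<epsilon>: "\<epsilon> > 0"
  shows "eventually (\<lambda>y. \<forall>k. prob {\<omega> \<in> space M. alive k \<omega> \<and> X k \<omega> > y / 2 \<and> exceeds (skip k) (horizon y) y (threshold y - X k \<omega>) \<omega>}
     \<le> survival k * ((1 + \<epsilon>) * exp (6/5 * \<eta>) * G y) + sqrt (survival k) * (\<epsilon> * G y)) at_top"
proof -
  \<comment> \<open>Net decay per slice: 19/20 of the rate 7/5, halved by the square root, is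
    133/200; subtracting the growth 3/5 of the tail leaves 13/200.\<close>
  define R where "R = exp (- (13/200) * \<eta>)"
  define K where "K = 8 * exp (6/5) * (\<Sum>m. R ^ m)"
  have R: "0 < R" "R < 1" using \<eta> by (auto simp: R_def)
  have sR: "summable (\<lambda>m. R ^ m)" using R by (intro summable_geometric) auto
  have "0 < (\<Sum>m. R ^ m)" using R by (intro suminf_pos sR) auto
  then have K: "K > 0" by (simp add: K_def)
  define \<epsilon>2 where "\<epsilon>2 = \<epsilon> / K"
  have \<epsilon>2: "\<epsilon>2 > 0" using \<epsilon> K by (simp add: \<epsilon>2_def)
  \<comment> \<open>Interpolation weight 1/20 turns the 40th power into a square, and the square
    root leaves \<open>\<epsilon>2\<close>.\<close>
  have e40: "\<epsilon>2 ^ 40 > 0" using \<epsilon>2 by simp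
  have \<eta>2: "2 * \<eta> > 0" using \<eta> by simp
  show ?thesis
    using eventually_threshold_gap[OF \<eta>(1)] eventually_threshold_gap[OF zero_less_one] eventually_Fbar_shift_le
      eventually_Fbar_shift_sharp[OF \<eta>2 \<epsilon>] eventually_exceeds_le eventually_exceeds_small[OF \<eta>(1) e40]
      eventually_gt_at_top[of 0] eventually_g_ge[of 1]
  proof eventually_elim
    case (elim y)
    define r where "r = y / g y"
    have r: "r > 0" "g y / y * r = 1" using elim by (auto simp: r_def)
    let ?h = "threshold y"
    show ?case
    proof
      fix k
      have first: "Fbar (?h - \<eta> * r) \<le> (1 + \<epsilon>) * exp (6/5 * \<eta>) * G y"
      proof -
        \<comment> \<open>One \<open>\<eta> * r\<close> is the slice width, the other bounds the gap
          between \<open>y\<close> and the threshold; the exponent is then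
          \<open>3/5 * 2 * \<eta>\<close>.\<close>
        have "Fbar (?h - \<eta> * r) \<le> Fbar (y - 2 * \<eta> * r)"
          using elim by (intro Fbar_antimono) (simp add: r_def algebra_simps)
        also have "\<dots> \<le> (1 + \<epsilon>) * exp (6/5 * \<eta>) * G y" using elim by (simp add: r_def)
        finally show ?thesis .
      qed
      have slice: "sqrt (survival k) * sqrt (prob {\<omega> \<in> space M. exceeds (skip k) (horizon y) y (real m * (\<eta> * r)) \<omega>})
           * Fbar (max (y / 2) (?h - (real m + 1) * (\<eta> * r))) \<le> sqrt (survival k) * \<epsilon>2 * (8 * exp (6/5)) * G y * R ^ m"
        if m: "1 \<le> m" for m :: nat
      proof -
        let ?p = "prob {\<omega> \<in> space M. exceeds (skip k) (horizon y) y (real m * (\<eta> * r)) \<omega>}"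
        have "?p \<le> prob {\<omega> \<in> space M. exceeds (skip k) (horizon y) y (\<eta> * r) \<omega>}"
        proof (intro finite_measure_mono, safe)
          fix \<omega> assume "exceeds (skip k) (horizon y) y (real m * (\<eta> * r)) \<omega>"
          moreover have "1 * (\<eta> * r) \<le> real m * (\<eta> * r)" using m \<eta> r by (intro mult_right_mono) auto
          ultimately show "exceeds (skip k) (horizon y) y (\<eta> * r) \<omega>" by (auto elim: exceeds_mono)
        qed auto
        also have "\<dots> \<le> \<epsilon>2 ^ 40" using elim inj_skip by (simp add: r_def)
        finally have p1: "?p \<le> \<epsilon>2 ^ 40" .
        have "?p \<le> exp (- (7/5) * (g y / y) * (real m * (\<eta> * r)))"
        proof -
          have "0 \<le> real m * (\<eta> * r)" using \<eta> r by simp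
          then show ?thesis using elim(5) inj_skip by blast
        qed
        also have "(7/5) * (g y / y) * (real m * (\<eta> * r)) = 7/5 * (real m * \<eta>)"
          using r(2) by (simp add: field_simps)
        then have "exp (- (7/5) * (g y / y) * (real m * (\<eta> * r))) = exp (- (7/5) * (real m * \<eta>))" by simp
        finally have p2: "?p \<le> exp (- (7/5) * (real m * \<eta>))" .
        have "?p \<le> (\<epsilon>2 ^ 40) powr (1/20) * exp (- (7/5) * (real m * \<eta>)) powr (1 - 1/20)"
          using p1 p2 by (intro le_weighted_geometric_mean) auto
        also have "(\<epsilon>2 ^ 40) powr (1/20) = \<epsilon>2\<^sup>2"
        proof -
          have "\<epsilon>2 ^ 40 = \<epsilon>2 powr 40" using \<epsilon>2 by simp
          then have "(\<epsilon>2 ^ 40) powr (1/20) = \<epsilon>2 powr 2" by (simp only: powr_powr) simp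
          then show ?thesis using \<epsilon>2 by simp
        qed
        also have "exp (- (7/5) * (real m * \<eta>)) powr (1 - 1/20) = (exp (- (133/200) * (real m * \<eta>)))\<^sup>2"
          by (simp add: exp_powr_real power2_eq_square exp_add[symmetric])
        finally have "sqrt ?p \<le> sqrt ((\<epsilon>2 * exp (- (133/200) * (real m * \<eta>)))\<^sup>2)"
          by (intro real_sqrt_le_mono) (simp add: power_mult_distrib)
        then have sp: "sqrt ?p \<le> \<epsilon>2 * exp (- (133/200) * (real m * \<eta>))" using \<epsilon>2 by simp
        \<comment> \<open>Clipping at \<open>y / 2\<close> stays within the range of the shift
          bound. The gap, at most \<open>r\<close>, and the extra slice together contribute
          \<open>3/5 * (1 + \<eta>) \<le> 6/5\<close> to the exponent.\<close>
        define v where "v = min (y / 2) (y - ?h + (real m + 1) * (\<eta> * r))"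
        have "0 \<le> y powr (1 - \<gamma>) / a" using a_pos by simp
        then have h: "?h \<le> y" using a_pos unfolding threshold_def by linarith
        have "0 \<le> (real m + 1) * (\<eta> * r)" using r \<eta> by simp
        then have v: "0 \<le> v" using h \<open>0 < y\<close> by (simp add: v_def)
        have v': "v \<le> y / 2" unfolding v_def by (rule min.cobounded1)
        have yv: "max (y / 2) (?h - (real m + 1) * (\<eta> * r)) = y - v" by (auto simp: v_def)
        have "g y / y * v \<le> g y / y * (r + (real m + 1) * (\<eta> * r))"
          using elim by (intro mult_left_mono) (auto simp: v_def r_def)
        also have "\<dots> = 1 + (real m + 1) * \<eta>" using r(2) by (simp add: field_simps)
        finally have "g y / y * v \<le> 1 + real m * \<eta> + \<eta>" by (simp add: distrib_right)
        moreover have "3/5 * (g y / y) * v = 3/5 * (g y / y * v)" by simp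
        ultimately have "3/5 * (g y / y) * v \<le> 6/5 + 3/5 * (real m * \<eta>)" using \<eta>(2) by linarith
        then have ex: "exp (3/5 * (g y / y) * v) \<le> exp (6/5) * exp (3/5 * (real m * \<eta>))"
          by (simp add: exp_add[symmetric])
        have "Fbar (y - v) \<le> 8 * G y * exp (3/5 * (g y / y) * v)" using elim(3) v v' by blast
        also have "\<dots> \<le> 8 * G y * (exp (6/5) * exp (3/5 * (real m * \<eta>)))"
          using ex G_nonneg by (intro mult_left_mono) auto
        finally have Fv: "Fbar (y - v) \<le> 8 * G y * (exp (6/5) * exp (3/5 * (real m * \<eta>)))" .
        have "sqrt (survival k) * sqrt ?p * Fbar (y - v)
            \<le> sqrt (survival k) * (\<epsilon>2 * exp (- (133/200) * (real m * \<eta>))) * (8 * G y * (exp (6/5) * exp (3/5 * (real m * \<eta>))))"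
          using sp Fv survival_nonneg[of k] \<epsilon>2 by (intro mult_mono mult_left_mono mult_nonneg_nonneg Fbar_nonneg) auto
        also have "\<dots> = sqrt (survival k) * \<epsilon>2 * (8 * exp (6/5)) * G y * (exp (- (133/200) * (real m * \<eta>)) * exp (3/5 * (real m * \<eta>)))"
          by simp
        also have "exp (- (133/200) * (real m * \<eta>)) * exp (3/5 * (real m * \<eta>)) = R ^ m"
          by (simp add: R_def exp_of_nat_mult[symmetric] exp_add[symmetric])
        finally show ?thesis unfolding yv .
      qed
      let ?L = "nat \<lfloor>(?h - y / 2) / (\<eta> * r)\<rfloor>"
      have "(\<Sum>m\<in>{1..?L}. sqrt (survival k) * sqrt (prob {\<omega> \<in> space M. exceeds (skip k) (horizon y) y (real m * (\<eta> * r)) \<omega>})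
           * Fbar (max (y / 2) (?h - (real m + 1) * (\<eta> * r))))
         \<le> (\<Sum>m\<in>{1..?L}. sqrt (survival k) * \<epsilon>2 * (8 * exp (6/5)) * G y * R ^ m)"
        by (intro sum_mono slice) auto
      also have "\<dots> = sqrt (survival k) * \<epsilon>2 * (8 * exp (6/5)) * G y * (\<Sum>m\<in>{1..?L}. R ^ m)"
        by (simp add: sum_distrib_left)
      also have "\<dots> \<le> sqrt (survival k) * \<epsilon>2 * (8 * exp (6/5)) * G y * (\<Sum>m. R ^ m)"
        using R \<epsilon>2 survival_nonneg[of k] G_nonneg[of y] by (intro mult_left_mono sum_le_suminf sR mult_nonneg_nonneg) auto
      also have "\<dots> = sqrt (survival k) * (\<epsilon>2 * K * G y)" by (simp add: K_def)
      also have "\<epsilon>2 * K = \<epsilon>" using K by (simp add: \<epsilon>2_def)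
      finally have second: "(\<Sum>m\<in>{1..?L}. sqrt (survival k) * sqrt (prob {\<omega> \<in> space M. exceeds (skip k) (horizon y) y (real m * (\<eta> * r)) \<omega>})
           * Fbar (max (y / 2) (?h - (real m + 1) * (\<eta> * r)))) \<le> sqrt (survival k) * (\<epsilon> * G y)" .
      have "\<eta> * r > 0" using \<eta> r by simp
      from prob_one_jump_le[OF this, of k y "horizon y" ?h] second
        mult_left_mono[OF first survival_nonneg[of k]]
      show "prob {\<omega> \<in> space M. alive k \<omega> \<and> X k \<omega> > y / 2 \<and> exceeds (skip k) (horizon y) y (threshold y - X k \<omega>) \<omega>}
     \<le> survival k * ((1 + \<epsilon>) * exp (6/5 * \<eta>) * G y) + sqrt (survival k) * (\<epsilon> * G y)" by linarith
    qed
  qed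
qed

lemma eventually_threshold_pos: "eventually (\<lambda>y. 9/10 * y \<le> threshold y) at_top"
  using eventually_threshold_gap[OF zero_less_one] eventually_g_ge[of 10] eventually_gt_at_top[of 0]
proof eventually_elim
  case (elim y)
  have "y / g y \<le> y / 10" using elim by (intro divide_left_mono) auto
  moreover have "y - threshold y \<le> y / g y" using elim by simp
  ultimately show ?case by linarith
qed

lemma eventually_no_jump:
  assumes \<epsilon>: "\<epsilon> > 0"
  shows "eventually (\<lambda>y. prob {\<omega> \<in> space M. exceeds id (horizon y) y (threshold y) \<omega>} \<le> \<epsilon> * G y) at_top"
proof -
  \<comment> \<open>The rate 7/5 at height \<open>9/10 * y\<close> gives
    \<open>63/50 = 1 + 13/50\<close>.\<close>
  have E: "eventually (\<lambda>y. exp (- (1 + 13/50) * g y) \<le> \<epsilon> * G y) at_top"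
    using \<epsilon> by (intro eventually_exp_le_G) auto
  with eventually_exceeds_le eventually_threshold_pos eventually_gt_at_top[of 0] show ?thesis
  proof eventually_elim
    case (elim y)
    have "prob {\<omega> \<in> space M. exceeds id (horizon y) y (threshold y) \<omega>} \<le> exp (- (7/5) * (g y / y) * threshold y)"
      using elim by (simp del: minus_mult_left mult_minus_left)
    also have "\<dots> \<le> exp (- (1 + 13/50) * g y)"
    proof -
      have "7/5 * (g y / y) * (9/10 * y) \<le> 7/5 * (g y / y) * threshold y"
        using elim g_nonneg[of y] by (intro mult_left_mono) auto
      then show ?thesis using elim by simp
    qed
    finally show ?case using elim by simp
  qed
qed

lemma exceeds_jump_measurable [measurable]: "Measurable.pred M (\<lambda>\<omega>. exceeds \<iota> n y (h - X k \<omega>) \<omega>)"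
proof -
  define T where "T j \<omega> = (\<Sum>i<j. min (X (\<iota> i) \<omega>) (y / 2) + a - y powr (-\<gamma>))" for j :: nat and \<omega>
  have [measurable]: "T j \<in> borel_measurable M" for j unfolding T_def by measurable
  have [measurable]: "Measurable.pred M (\<lambda>\<omega>. h - X k \<omega> \<le> T j \<omega>)" for j by measurable
  show ?thesis unfolding exceeds_def T_def[symmetric] by measurable
qed

text \<open>One parameter \<open>s\<close> serves as slice width and as error. The survival weights
  turn the sum over all jump times into convergent series, so the length of the horizon does not
  enter the bound.\<close>

lemma area_upper_explicit:
  assumes s: "0 < s" "s \<le> 1" and \<epsilon>: "\<epsilon> > 0"
  shows "eventually (\<lambda>y. prob {\<omega> \<in> space M. rw_area X \<omega> > y\<^sup>2 / (2 * a)}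
    \<le> (suminf survival * ((1 + s) * exp (6/5 * s)) + (\<Sum>k. sqrt (survival k)) * s + 3 * \<epsilon>) * G y) at_top"
proof -
  define Q where "Q = suminf survival"
  define Q' where "Q' = (\<Sum>k. sqrt (survival k))"
  have "((\<lambda>z::real. z powr (-\<gamma>)) \<longlongrightarrow> 0) at_top"
    using \<gamma> by (intro tendsto_neg_powr filterlim_ident) auto
  then have small: "eventually (\<lambda>z::real. z powr (-\<gamma>) < a) at_top"
    using a_pos by (intro order_tendstoD) auto
  show ?thesis
    using eventually_survival_horizon[OF \<epsilon>] eventually_two_jumps[OF \<epsilon>] eventually_no_jump[OF \<epsilon>]
      eventually_one_jump[OF s s(1)] eventually_threshold_pos eventually_gt_at_top[of 0] small
  proof eventually_elim
    case (elim y)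
    let ?N = "horizon y"
    let ?A = "{\<omega> \<in> space M. rw_area X \<omega> > y\<^sup>2 / (2 * a)}"
    let ?E1 = "{\<omega> \<in> space M. alive ?N \<omega>}"
    let ?E2 = "{\<omega> \<in> space M. \<exists>i<?N. \<exists>j<?N. i \<noteq> j \<and> X i \<omega> > y / 2 \<and> X j \<omega> > y / 2}"
    let ?E3 = "{\<omega> \<in> space M. exceeds id ?N y (threshold y) \<omega>}"
    let ?D = "\<lambda>k. {\<omega> \<in> space M. alive k \<omega> \<and> X k \<omega> > y / 2 \<and> exceeds (skip k) ?N y (threshold y - X k \<omega>) \<omega>}"
    have Dm: "?D k \<in> events" for k by measurable
    have Em: "?E1 \<in> events" "?E2 \<in> events" "?E3 \<in> events" by measurable
    have Um: "(\<Union>k<?N. ?D k) \<in> events" using Dm by (intro sets.finite_UN) auto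
    have thr: "0 \<le> threshold y" using elim(5,6) by linarith
    have "?A \<subseteq> ?E1 \<union> ?E2 \<union> ?E3 \<union> (\<Union>k<?N. ?D k)"
    proof
      fix \<omega> assume "\<omega> \<in> ?A"
      then have "\<omega> \<in> space M" "y\<^sup>2 / (2 * a) < rw_area X \<omega>" by auto
      then show "\<omega> \<in> ?E1 \<union> ?E2 \<union> ?E3 \<union> (\<Union>k<?N. ?D k)"
        using area_large_cases[of y \<omega> ?N, OF elim(6) elim(7) thr]
        by blast
    qed
    then have "prob ?A \<le> prob (?E1 \<union> ?E2 \<union> ?E3 \<union> (\<Union>k<?N. ?D k))"
      by (intro finite_measure_mono sets.Un Em Um)
    moreover have "prob (?E1 \<union> ?E2 \<union> ?E3 \<union> (\<Union>k<?N. ?D k)) \<le> prob (?E1 \<union> ?E2 \<union> ?E3) + prob (\<Union>k<?N. ?D k)"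
      by (intro measure_Un_le sets.Un Em Um)
    moreover have "prob (?E1 \<union> ?E2 \<union> ?E3) \<le> prob (?E1 \<union> ?E2) + prob ?E3" by (intro measure_Un_le sets.Un Em)
    moreover have "prob (?E1 \<union> ?E2) \<le> prob ?E1 + prob ?E2" by (intro measure_Un_le Em)
    moreover have "prob (\<Union>k<?N. ?D k) \<le> Q * ((1 + s) * exp (6/5 * s) * G y) + Q' * (s * G y)"
    proof -
      have "prob (\<Union>k<?N. ?D k) \<le> (\<Sum>k<?N. prob (?D k))"
        using Dm by (intro finite_measure_subadditive_finite image_subsetI finite_lessThan)
      also have "\<dots> \<le> (\<Sum>k<?N. survival k * ((1 + s) * exp (6/5 * s) * G y) + sqrt (survival k) * (s * G y))"
        by (intro sum_mono) (rule elim(4)[rule_format])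
      also have "\<dots> = (\<Sum>k<?N. survival k) * ((1 + s) * exp (6/5 * s) * G y) + (\<Sum>k<?N. sqrt (survival k)) * (s * G y)"
        by (simp add: sum.distrib sum_distrib_right)
      also have "\<dots> \<le> Q * ((1 + s) * exp (6/5 * s) * G y) + Q' * (s * G y)"
        unfolding Q_def Q'_def using s(1) G_nonneg[of y] survival_nonneg
        by (intro add_mono mult_right_mono sum_le_suminf summable_survival summable_sqrt_survival mult_nonneg_nonneg) auto
      finally show ?thesis .
    qed
    ultimately have "prob ?A \<le> prob ?E1 + prob ?E2 + prob ?E3 + (Q * ((1 + s) * exp (6/5 * s) * G y) + Q' * (s * G y))"
      by linarith
    also have "\<dots> \<le> \<epsilon> * G y + \<epsilon> * G y + \<epsilon> * G y + (Q * ((1 + s) * exp (6/5 * s) * G y) + Q' * (s * G y))"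
      using elim(1-3) by (intro add_mono order_refl) (simp_all only: survival_def)
    also have "\<dots> = (Q * ((1 + s) * exp (6/5 * s)) + Q' * s + 3 * \<epsilon>) * G y"
      by (simp add: algebra_simps)
    finally show ?case unfolding Q_def Q'_def .
  qed
qed

lemma area_upper:
  assumes \<epsilon>: "\<epsilon> > 0"
  shows "eventually (\<lambda>y. prob {\<omega> \<in> space M. rw_area X \<omega> > y\<^sup>2 / (2 * a)} \<le> (suminf survival + \<epsilon>) * G y) at_top"
proof -
  let ?B = "\<lambda>s. suminf survival * ((1 + s) * exp (6/5 * s)) + (\<Sum>k. sqrt (survival k)) * s + 3 * s"
  have "(?B \<longlongrightarrow> suminf survival * ((1 + 0) * exp (6/5 * 0)) + (\<Sum>k. sqrt (survival k)) * 0 + 3 * 0) (at_right 0)"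
    by (intro tendsto_intros)
  from order_tendstoD(2)[OF this, of "suminf survival + \<epsilon>"]
  have "eventually (\<lambda>s. ?B s < suminf survival + \<epsilon>) (at_right 0)" using \<epsilon> by simp
  moreover have "eventually (\<lambda>s::real. s \<in> {0<..<1}) (at_right 0)"
    by (rule eventually_at_right_real) simp
  ultimately have "eventually (\<lambda>s. ?B s < suminf survival + \<epsilon> \<and> s \<in> {0<..<1}) (at_right 0)"
    by (rule eventually_conj)
  then have "\<exists>s. ?B s < suminf survival + \<epsilon> \<and> s \<in> {0<..<1}"
    by (rule eventually_happens'[rotated]) (rule trivial_limit_at_right_real)
  then obtain s where s: "?B s < suminf survival + \<epsilon>" "0 < s" "s < 1"
    unfolding greaterThanLessThan_iff by blast
  show ?thesis
    using area_upper_explicit[OF s(2) less_imp_le[OF s(3)] s(2)]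
  proof eventually_elim
    case (elim y)
    also have "?B s * G y \<le> (suminf survival + \<epsilon>) * G y"
      using s(1) by (intro mult_right_mono G_nonneg less_imp_le)
    finally show ?case .
  qed
qed


subsection \<open>Lower bound\<close>

text \<open>A Kolmogorov-type bound from second moments: Chebyshev handles single increments beyond
  \<open>b\<close>, the exponential maximal inequality the truncated rest. Both are controlled by
  \<open>n * V / b^2\<close>, which is of order \<open>(g y)^2 / y\<close> and tends to
  zero.\<close>

lemma eventually_fluctuation_small:
  assumes \<eta>: "\<eta> > 0" and \<epsilon>: "\<epsilon> > 0"
  shows "eventually (\<lambda>y. \<forall>k. prob {\<omega> \<in> space M. \<exists>j\<le>nat \<lceil>y / a\<rceil>.
      \<eta> * (y / g y) \<le> (\<Sum>i<j. - (X (Suc k + i) \<omega> + a))} \<le> \<epsilon>) at_top"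
proof -
  \<comment> \<open>\<open>L\<close> is the ratio of the level \<open>w\<close> to the truncation
    \<open>b\<close>. The final exponent is at most \<open>1 - L\<close>, hence at most
    \<open>ln (\<epsilon> / 2)\<close>.\<close>
  define L where "L = max 1 (1 - ln (\<epsilon> / 2))"
  have L: "L > 0" "1 - L \<le> ln (\<epsilon> / 2)" by (auto simp: L_def)
  define V where "V = variance (X 0)"
  have V: "V = expectation (\<lambda>\<omega>. (X 0 \<omega> + a)\<^sup>2)" by (simp add: V_def mean)
  have V0: "V \<ge> 0" by (simp add: V)
  have Vint: "integrable M (\<lambda>\<omega>. (X 0 \<omega> + a)\<^sup>2)"
    using integ var by (simp add: power2_sum)
  define c where "c = 2 / a * (L\<^sup>2 * V / \<eta>\<^sup>2)"
  have "((\<lambda>y. c * ((g y / y * y powr \<gamma>) * (g y * y powr (-\<gamma>)))) \<longlongrightarrow> c * (0 * 0)) at_top"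
    by (intro tendsto_intros g_div_powr_lim g_powr_lim)
  then have "eventually (\<lambda>y. c * ((g y / y * y powr \<gamma>) * (g y * y powr (-\<gamma>))) < min 1 (\<epsilon> / 2)) at_top"
    using \<epsilon> by (intro order_tendstoD(2)) auto
  then show ?thesis
    using eventually_gt_at_top[of 0] eventually_ge_at_top[of a] eventually_g_ge[of 1]
  proof eventually_elim
    case (elim y)
    define n where "n = nat \<lceil>y / a\<rceil>"
    define w where "w = \<eta> * (y / g y)"
    define b where "b = w / L"
    have w: "w > 0" using \<eta> elim by (simp add: w_def)
    have b: "b > 0" using w L by (simp add: b_def)
    have "1 \<le> y / a" using elim a_pos by simp
    then have n: "real n \<le> 2 * (y / a)" unfolding n_def by linarith
    have "real n * V / b\<^sup>2 \<le> (2 * (y / a)) * V / b\<^sup>2"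
      using n V0 by (intro divide_right_mono mult_right_mono) auto
    also have "\<dots> = c * ((g y / y) * g y)"
      using elim L \<eta> a_pos by (simp add: b_def w_def c_def power2_eq_square field_simps)
    also have "(g y / y) * g y = (g y / y * y powr \<gamma>) * (g y * y powr (-\<gamma>))"
      using elim by (simp add: powr_minus)
    finally have nV: "real n * V / b\<^sup>2 \<le> min 1 (\<epsilon> / 2)" using elim by linarith
    define \<theta> where "\<theta> = 1 / b"
    have \<theta>: "\<theta> > 0" using b by (simp add: \<theta>_def)
    \<comment> \<open>Centring removes the first-order term, and the compensator
      \<open>\<theta> * V\<close> offsets the second-order one; over \<open>n\<close> steps it
      lowers the level from \<open>w\<close> to \<open>u\<close>.\<close>
    define f where "f x = min (- (x + a)) b - \<theta> * V" for x
    have [measurable]: "f \<in> borel_measurable borel" unfolding f_def by measurable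
    have point: "exp (\<theta> * min (- (x + a)) b) \<le> 1 + (- \<theta>) * (x + a) + \<theta>\<^sup>2 * (x + a)\<^sup>2" for x
    proof -
      let ?m = "min (- (x + a)) b"
      have "\<theta> * ?m \<le> \<theta> * b" using \<theta> by (intro mult_left_mono) auto
      then have "\<theta> * ?m \<le> 1" using b by (simp add: \<theta>_def)
      then have "exp (\<theta> * ?m) \<le> 1 + \<theta> * ?m + (\<theta> * ?m)\<^sup>2" by (rule exp_le_quadratic)
      moreover have "\<theta> * ?m \<le> \<theta> * (- (x + a))" using \<theta> by (intro mult_left_mono) auto
      moreover have "?m\<^sup>2 \<le> (x + a)\<^sup>2"
        using b by (intro iffD1[OF abs_le_square_iff]) (auto simp: min_def)
      then have "(\<theta> * ?m)\<^sup>2 \<le> \<theta>\<^sup>2 * (x + a)\<^sup>2"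
        unfolding power_mult_distrib by (intro mult_left_mono) auto
      moreover have "(- \<theta>) * (x + a) = \<theta> * (- (x + a))" by (simp add: algebra_simps)
      ultimately show ?thesis by linarith
    qed
    have expint: "integrable M (\<lambda>\<omega>. exp (\<theta> * min (- (X i \<omega> + a)) b))" for i
      by (rule integrable_const_bound[where B="exp (\<theta> * b)"]) (use \<theta> in \<open>auto intro!: mult_left_mono\<close>)
    have E1: "expectation (\<lambda>\<omega>. exp (\<theta> * min (- (X 0 \<omega> + a)) b)) \<le> exp (\<theta>\<^sup>2 * V)"
    proof -
      have "expectation (\<lambda>\<omega>. exp (\<theta> * min (- (X 0 \<omega> + a)) b))
         \<le> expectation (\<lambda>\<omega>. 1 + (- \<theta>) * (X 0 \<omega> + a) + \<theta>\<^sup>2 * (X 0 \<omega> + a)\<^sup>2)"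
      proof (rule integral_mono[OF expint])
        have "integrable M (\<lambda>\<omega>. - \<theta> * (X 0 \<omega> + a))" "integrable M (\<lambda>\<omega>. \<theta>\<^sup>2 * (X 0 \<omega> + a)\<^sup>2)"
          using integ Vint by (auto intro!: integrable_mult_right)
        then show "integrable M (\<lambda>\<omega>. 1 + (- \<theta>) * (X 0 \<omega> + a) + \<theta>\<^sup>2 * (X 0 \<omega> + a)\<^sup>2)"
          by (intro Bochner_Integration.integrable_add) auto
      qed (rule point)
      also have "\<dots> = expectation (\<lambda>\<omega>. 1 + (- \<theta>) * (X 0 \<omega> + a)) + expectation (\<lambda>\<omega>. \<theta>\<^sup>2 * (X 0 \<omega> + a)\<^sup>2)"
        using integ Vint by (intro Bochner_Integration.integral_add integrable_mult_right) auto
      also have "expectation (\<lambda>\<omega>. 1 + (- \<theta>) * (X 0 \<omega> + a)) = 1"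
        using integ by (simp add: mean prob_space)
      also have "expectation (\<lambda>\<omega>. \<theta>\<^sup>2 * (X 0 \<omega> + a)\<^sup>2) = \<theta>\<^sup>2 * V" by (simp add: V)
      also have "1 + \<theta>\<^sup>2 * V \<le> exp (\<theta>\<^sup>2 * V)" by (rule exp_ge_add_one_self)
      finally show ?thesis .
    qed
    have eq: "exp (\<theta> * f x) = exp (- (\<theta>\<^sup>2 * V)) * exp (\<theta> * min (- (x + a)) b)" for x
      unfolding f_def exp_add[symmetric] by (rule arg_cong[where f=exp]) (simp add: power2_eq_square algebra_simps)
    have int: "integrable M (\<lambda>\<omega>. exp (\<theta> * f (X i \<omega>)))" for i
      unfolding eq by (intro integrable_mult_right expint)
    have le1: "expectation (\<lambda>\<omega>. exp (\<theta> * f (X i \<omega>))) \<le> 1" for i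
    proof -
      have "expectation (\<lambda>\<omega>. exp (\<theta> * f (X i \<omega>))) = expectation (\<lambda>\<omega>. exp (\<theta> * f (X 0 \<omega>)))"
        by (rule expectation_X) measurable
      also have "\<dots> = exp (- (\<theta>\<^sup>2 * V)) * expectation (\<lambda>\<omega>. exp (\<theta> * min (- (X 0 \<omega> + a)) b))"
        unfolding eq by simp
      also have "\<dots> \<le> exp (- (\<theta>\<^sup>2 * V)) * exp (\<theta>\<^sup>2 * V)" by (intro mult_left_mono E1) auto
      finally show ?thesis by (simp add: exp_add[symmetric])
    qed
    have cheb: "prob {\<omega> \<in> space M. b < - (X i \<omega> + a)} \<le> V / b\<^sup>2" for i
    proof -
      have eq: "{\<omega> \<in> space M. b < - (X i \<omega> + a)} = X i -` {..< - a - b} \<inter> space M" for i by auto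
      have "prob {\<omega> \<in> space M. b < - (X i \<omega> + a)} = measure (distr M borel (X i)) {..< - a - b}" for i
        unfolding eq by (rule measure_distr[symmetric]) measurable
      then have "prob {\<omega> \<in> space M. b < - (X i \<omega> + a)} = prob {\<omega> \<in> space M. b < - (X 0 \<omega> + a)}"
        by (simp only: ident[of i])
      also have "\<dots> \<le> prob {\<omega> \<in> space M. b \<le> \<bar>X 0 \<omega> - expectation (X 0)\<bar>}"
        by (intro finite_measure_mono) (auto simp: mean)
      also have "\<dots> \<le> V / b\<^sup>2" unfolding V_def using var b by (intro Chebyshev_inequality) auto
      finally show ?thesis .
    qed
    show ?case unfolding n_def[symmetric] w_def[symmetric]
    proof
      fix k
      define u where "u = w - real n * (\<theta> * V)"
      let ?J = "\<Union>i<n. {\<omega> \<in> space M. b < - (X (Suc k + i) \<omega> + a)}"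
      let ?E = "{\<omega> \<in> space M. \<exists>j\<le>n. u \<le> (\<Sum>i<j. f (X (Suc k + i) \<omega>))}"
      let ?B = "{\<omega> \<in> space M. \<exists>j\<le>n. w \<le> (\<Sum>i<j. - (X (Suc k + i) \<omega> + a))}"
      have "?B \<subseteq> ?J \<union> ?E"
      proof (rule subsetI, rule UnCI)
        fix \<omega> assume B: "\<omega> \<in> ?B" and nE: "\<omega> \<notin> ?E"
        show "\<omega> \<in> ?J"
        proof (rule ccontr)
          assume nJ: "\<omega> \<notin> ?J"
          obtain j where j: "j \<le> n" "w \<le> (\<Sum>i<j. - (X (Suc k + i) \<omega> + a))" using B by blast
          have "(\<Sum>i<j. f (X (Suc k + i) \<omega>)) = (\<Sum>i<j. - (X (Suc k + i) \<omega> + a) - \<theta> * V)"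
          proof (rule sum.cong)
            fix i assume "i \<in> {..<j}"
            then have "\<not> b < - (X (Suc k + i) \<omega> + a)" using nJ B j(1) by auto
            then show "f (X (Suc k + i) \<omega>) = - (X (Suc k + i) \<omega> + a) - \<theta> * V" by (simp add: f_def)
          qed simp
          also have "\<dots> = (\<Sum>i<j. - (X (Suc k + i) \<omega> + a)) - real j * (\<theta> * V)" by (simp add: sum_subtractf)
          also have "\<dots> \<ge> u"
          proof -
            have "real j * (\<theta> * V) \<le> real n * (\<theta> * V)" using j \<theta> V0 by (intro mult_right_mono) auto
            then show ?thesis using j by (simp add: u_def)
          qed
          finally show False using nE B j(1) by blast
        qed
      qed
      then have "prob ?B \<le> prob (?J \<union> ?E)" by (intro finite_measure_mono) auto
      also have "\<dots> \<le> prob ?J + prob ?E" by (intro measure_Un_le) auto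
      finally have 1: "prob ?B \<le> prob ?J + prob ?E" .
      have "prob ?J \<le> (\<Sum>i<n. prob {\<omega> \<in> space M. b < - (X (Suc k + i) \<omega> + a)})"
        by (intro finite_measure_subadditive_finite) auto
      also have "\<dots> \<le> (\<Sum>i<n. V / b\<^sup>2)" by (intro sum_mono cheb)
      also have "\<dots> \<le> \<epsilon> / 2" using nV by simp
      finally have 2: "prob ?J \<le> \<epsilon> / 2" .
      have "prob ?E \<le> exp (- \<theta> * u)"
        using exp_maximal_inequality[of X "\<lambda>i. Suc k + i" \<theta> f n u] indep \<theta> int le1 by (simp add: inj_def)
      also have "- \<theta> * u = - L + real n * V / b\<^sup>2"
        using b L w by (simp add: \<theta>_def u_def b_def power2_eq_square field_simps)
      also have "exp (- L + real n * V / b\<^sup>2) \<le> exp (ln (\<epsilon> / 2))" using nV L by simp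
      also have "\<dots> = \<epsilon> / 2" using \<epsilon> by simp
      finally show "prob ?B \<le> \<epsilon>" using 1 2 by linarith
    qed
  qed
qed

text \<open>The margin \<open>w\<close> in the jump pays for later fluctuations, so the walk stays
  above the line from \<open>y\<close> with slope \<open>-a\<close> until this line reaches zero.
  These points alone exceed the triangle; all other sums before \<open>rw_tau\<close> are
  nonnegative.\<close>

lemma area_gt:
  assumes y: "0 < y" and w: "0 \<le> w" and na: "\<not> alive m \<omega>" and al: "alive k \<omega>" and jump: "y + w < X k \<omega>"
    and fluct: "\<not> (\<exists>j\<le>nat \<lceil>y / a\<rceil>. w \<le> (\<Sum>i<j. - (X (Suc k + i) \<omega> + a)))"
  shows "y\<^sup>2 / (2 * a) < rw_area X \<omega>"
proof -
  define n where "n = nat \<lceil>y / a\<rceil>"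
  define T where "T = rw_tau X \<omega>"
  note tau = rw_tau_le[OF na]
  have ya: "0 < y / a" using y a_pos by simp
  then have n1: "1 \<le> n" unfolding n_def by linarith
  have rn: "y / a \<le> real n" "real n < y / a + 1" using ya unfolding n_def by linarith+
  have S0: "0 \<le> rw_S X j \<omega>" if "j \<le> k" for j
    using al that by (cases "j = 0") (auto simp: alive_def rw_S_def less_imp_le)
  have S_post: "y - a * real j < rw_S X (Suc k + j) \<omega>" if "j \<le> n" for j
  proof -
    have "rw_S X (Suc k + j) \<omega> = rw_S X k \<omega> + X k \<omega> + (\<Sum>i<j. X (Suc k + i) \<omega>)"
      by (induction j) (auto simp: rw_S_def)
    moreover have "\<not> w \<le> (\<Sum>i<j. - (X (Suc k + i) \<omega> + a))" using fluct that unfolding n_def by blast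
    then have "- w < (\<Sum>i<j. X (Suc k + i) \<omega>) + real j * a"
      by (simp add: sum_negf sum_subtractf)
    ultimately show ?thesis using S0[of k] jump by (simp add: algebra_simps)
  qed
  have S_pos: "0 < rw_S X (Suc k + j) \<omega>" if "j < n" for j
  proof -
    have "real j \<le> real n - 1" using that by linarith
    then have "real j < y / a" using rn by linarith
    then have "0 < y - a * real j" using a_pos by (simp add: field_simps)
    then show ?thesis using S_post[of j] that by linarith
  qed
  have "alive (k + n) \<omega>" unfolding alive_def
  proof
    fix j assume j: "j \<in> {1..k + n}"
    show "0 < rw_S X j \<omega>"
    proof (cases "j \<le> k")
      case True
      then show ?thesis using al j by (auto simp: alive_def)
    next
      case False
      then have "j = Suc k + (j - Suc k)" "j - Suc k < n" using j by auto
      then show ?thesis using S_pos[of "j - Suc k"] by simp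
    qed
  qed
  then have kT: "k + n < T" using tau(2) by (simp add: T_def)
  have S_nonneg: "0 \<le> rw_S X j \<omega>" if "j < T" for j
  proof (cases "j = 0")
    case False
    then show ?thesis using tau(2)[of j] that by (auto simp: T_def alive_def less_imp_le)
  qed (simp add: rw_S_def)
  have gauss: "(\<Sum>j<n. y - a * real j) = real n * y - a * (real n * (real n - 1)) / 2" for n
    by (induction n) (simp_all add: algebra_simps add_divide_distrib diff_divide_distrib)
  have "y\<^sup>2 / (2 * a) \<le> real n * y - a * (real n * (real n - 1)) / 2"
  proof -
    \<comment> \<open>The rounding excess of \<open>n\<close>. With it the sum exceeds the triangle
      by \<open>y / 2 + a * d * (1 - d) / 2\<close>, nonnegative because
      \<open>0 \<le> d \<le> 1\<close>.\<close>
    define d where "d = real n - y / a"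
    have d: "0 \<le> d" "d \<le> 1" using rn by (auto simp: d_def)
    have nd: "real n = y / a + d" by (simp add: d_def)
    have "real n * y - a * (real n * (real n - 1)) / 2 = y\<^sup>2 / (2 * a) + (y / 2 + a * d * (1 - d) / 2)"
      unfolding nd using a_pos by (simp add: power2_eq_square field_simps)
    moreover have "0 \<le> y / 2 + a * d * (1 - d) / 2" using d a_pos y by simp
    ultimately show ?thesis by linarith
  qed
  also have "\<dots> = (\<Sum>j<n. y - a * real j)" by (rule gauss[symmetric])
  also have "\<dots> < (\<Sum>j<n. rw_S X (Suc k + j) \<omega>)"
    using n1 by (intro sum_strict_mono S_post) (auto simp: lessThan_empty_iff)
  also have "\<dots> = (\<Sum>j\<in>(\<lambda>j. Suc k + j) ` {..<n}. rw_S X j \<omega>)"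
    by (subst sum.reindex) (auto simp: inj_on_def)
  also have "\<dots> \<le> (\<Sum>j<T. rw_S X j \<omega>)"
    using kT by (intro sum_mono2) (auto intro: S_nonneg)
  also have "\<dots> = rw_area X \<omega>" by (simp add: rw_area_def T_def)
  finally show ?thesis .
qed

lemma survival_lim: "survival \<longlonglongrightarrow> 0"
  by (rule summable_LIMSEQ_zero[OF summable_survival])

lemma AE_not_alive: "AE \<omega> in M. \<exists>m. \<not> alive m \<omega>"
proof -
  let ?Z = "{\<omega> \<in> space M. \<forall>m. alive m \<omega>}"
  have "prob ?Z \<le> survival m" for m
    unfolding survival_def by (intro finite_measure_mono) auto
  then have "prob ?Z \<le> 0" by (intro LIMSEQ_le_const[OF survival_lim]) auto
  then have "prob ?Z = 0" by (simp add: measure_le_0_iff)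
  then have "AE \<omega> in M. \<omega> \<notin> ?Z" by (subst (asm) prob_eq_0) auto
  with AE_space show ?thesis by eventually_elim auto
qed

text \<open>Requiring the first increment above \<open>t\<close> to be at \<open>k\<close> makes the
  events disjoint in \<open>k\<close>, so their probabilities will add; this costs at most
  \<open>K * s\<close>. Past, jump and future use disjoint blocks, so the product formula is
  exact.\<close>

lemma prob_jump_scenario_ge:
  assumes s: "k \<le> K" "Fbar t \<le> s"
    and fl: "prob {\<omega> \<in> space M. \<exists>j\<le>n. w \<le> (\<Sum>i<j. - (X (Suc k + i) \<omega> + a))} \<le> s" and s1: "s \<le> 1"
  shows "(survival k - real K * s) * (Fbar t * (1 - s))
    \<le> prob {\<omega> \<in> space M. ((alive k \<omega> \<and> (\<forall>i<k. X i \<omega> \<le> t)) \<and> t < X k \<omega>)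
         \<and> \<not> (\<exists>j\<le>n. w \<le> (\<Sum>i<j. - (X (Suc k + i) \<omega> + a)))}"
proof -
  let ?P = "\<lambda>f. (\<forall>j\<in>{1..k}. 0 < (\<Sum>i<j. f i)) \<and> (\<forall>i<k. f i \<le> t)"
  let ?Q = "\<lambda>f::nat \<Rightarrow> real. \<not> (\<exists>j\<le>n. w \<le> (\<Sum>i<j. - (f (Suc k + i) + a)))"
  have P_cong: "?P f = ?P h" if "\<And>i. i \<in> {..<k} \<Longrightarrow> f i = h i" for f h :: "nat \<Rightarrow> real"
  proof -
    have "(\<Sum>i<j. f i) = (\<Sum>i<j. h i)" if "j \<le> k" for j
      using that \<open>\<And>i. i \<in> {..<k} \<Longrightarrow> f i = h i\<close> by (intro sum.cong) auto
    then show ?thesis using that by auto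
  qed
  have "prob {\<omega> \<in> space M. (?P (\<lambda>i. X i \<omega>) \<and> t < X k \<omega>) \<and> ?Q (\<lambda>i. X i \<omega>)}
     = prob {\<omega> \<in> space M. ?P (\<lambda>i. X i \<omega>) \<and> t < X k \<omega>} * prob {\<omega> \<in> space M. ?Q (\<lambda>i. X i \<omega>)}"
  proof (rule prob_disjoint_coords[OF indep, where A="{..k}" and B="{k<..}" and P="\<lambda>f. ?P f \<and> t < f k" and Q="?Q"])
    fix f h :: "nat \<Rightarrow> real"
    show "(?P f \<and> t < f k) = (?P h \<and> t < h k)" if "\<And>i. i \<in> {..k} \<Longrightarrow> f i = h i"
      using P_cong[of f h] that by simp
    show "?Q f = ?Q h" if "\<And>i. i \<in> {k<..} \<Longrightarrow> f i = h i" using that by simp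
  qed auto
  also have "prob {\<omega> \<in> space M. ?P (\<lambda>i. X i \<omega>) \<and> t < X k \<omega>}
     = prob {\<omega> \<in> space M. ?P (\<lambda>i. X i \<omega>)} * prob {\<omega> \<in> space M. t < X k \<omega>}"
    by (rule prob_disjoint_coords[OF indep, where A="{..<k}" and B="{k}" and P="?P" and Q="\<lambda>f. t < f k"])
       (auto intro: P_cong)
  finally have eq: "prob {\<omega> \<in> space M. ((alive k \<omega> \<and> (\<forall>i<k. X i \<omega> \<le> t)) \<and> t < X k \<omega>)
         \<and> \<not> (\<exists>j\<le>n. w \<le> (\<Sum>i<j. - (X (Suc k + i) \<omega> + a)))}
     = prob {\<omega> \<in> space M. alive k \<omega> \<and> (\<forall>i<k. X i \<omega> \<le> t)} * Fbar t
        * prob {\<omega> \<in> space M. \<not> (\<exists>j\<le>n. w \<le> (\<Sum>i<j. - (X (Suc k + i) \<omega> + a)))}"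
    unfolding alive_def rw_S_def prob_X_gt .
  have post: "1 - s \<le> prob {\<omega> \<in> space M. \<not> (\<exists>j\<le>n. w \<le> (\<Sum>i<j. - (X (Suc k + i) \<omega> + a)))}"
    using fl by (subst prob_neg) auto
  have "survival k \<le> prob ({\<omega> \<in> space M. alive k \<omega> \<and> (\<forall>i<k. X i \<omega> \<le> t)} \<union> {\<omega> \<in> space M. \<exists>i<k. X (id i) \<omega> > t})"
    unfolding survival_def by (intro finite_measure_mono) (auto simp: not_le)
  also have "\<dots> \<le> prob {\<omega> \<in> space M. alive k \<omega> \<and> (\<forall>i<k. X i \<omega> \<le> t)} + prob {\<omega> \<in> space M. \<exists>i<k. X (id i) \<omega> > t}"
    by (intro measure_Un_le) auto
  also have "prob {\<omega> \<in> space M. \<exists>i<k. X (id i) \<omega> > t} \<le> real k * Fbar t" by (rule prob_ex_X_gt_le)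
  also have "\<dots> \<le> real K * s" using s by (intro mult_mono) (auto simp: Fbar_nonneg)
  finally have pre: "survival k - real K * s \<le> prob {\<omega> \<in> space M. alive k \<omega> \<and> (\<forall>i<k. X i \<omega> \<le> t)}" by simp
  have "(survival k - real K * s) * (Fbar t * (1 - s))
     \<le> prob {\<omega> \<in> space M. alive k \<omega> \<and> (\<forall>i<k. X i \<omega> \<le> t)} * (Fbar t * (1 - s))"
    using pre s1 by (intro mult_right_mono) (auto simp: Fbar_nonneg)
  also have "\<dots> \<le> prob {\<omega> \<in> space M. alive k \<omega> \<and> (\<forall>i<k. X i \<omega> \<le> t)}
      * (Fbar t * prob {\<omega> \<in> space M. \<not> (\<exists>j\<le>n. w \<le> (\<Sum>i<j. - (X (Suc k + i) \<omega> + a)))})"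
    using post by (intro mult_left_mono) (auto simp: Fbar_nonneg)
  finally show ?thesis unfolding eq by (simp add: mult.assoc)
qed

lemma eventually_Fbar_small:
  assumes "s > 0"
  shows "eventually (\<lambda>y. Fbar y \<le> s) at_top"
  using eventually_horizon_Fbar[OF zero_less_one assms] eventually_ge_at_top[of 1]
proof eventually_elim
  case (elim y)
  have "1 \<le> y\<^sup>2" using elim by simp
  then have "1 \<le> real (horizon y)" using horizon_ge[of y] by linarith
  then have "1 * Fbar y \<le> real (horizon y) * Fbar y" by (intro mult_right_mono Fbar_nonneg)
  then show ?case using elim by simp
qed

lemma area_lower_explicit:
  assumes s: "0 < s" "s < 1" and pos: "0 \<le> (\<Sum>k<K. survival k) - real K * (real K * s)"
  shows "eventually (\<lambda>y. ((\<Sum>k<K. survival k) - real K * (real K * s)) * ((1 - s) * exp (- s) * (1 - s)) * G y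
      \<le> prob {\<omega> \<in> space M. rw_area X \<omega> > y\<^sup>2 / (2 * a)}) at_top"
  using eventually_fluctuation_small[OF s(1) s(1)] eventually_Fbar_shift_ge[OF s(1) s] eventually_Fbar_small[OF s(1)]
    eventually_gt_at_top[of 0] eventually_g_ge[of 1]
proof eventually_elim
  case (elim y)
  define w where "w = s * (y / g y)"
  define n where "n = nat \<lceil>y / a\<rceil>"
  have w: "0 \<le> w" using s elim(4,5) by (simp add: w_def)
  let ?E = "\<lambda>k. {\<omega> \<in> space M. ((alive k \<omega> \<and> (\<forall>i<k. X i \<omega> \<le> y + w)) \<and> y + w < X k \<omega>)
         \<and> \<not> (\<exists>j\<le>n. w \<le> (\<Sum>i<j. - (X (Suc k + i) \<omega> + a)))}"
  let ?A = "{\<omega> \<in> space M. rw_area X \<omega> > y\<^sup>2 / (2 * a)}"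
  have Em: "?E k \<in> events" for k by measurable
  have Ft: "Fbar (y + w) \<le> s" using elim(3) Fbar_antimono[of y "y + w"] w by linarith
  have disj: "disjoint_family_on ?E {..<K}"
    unfolding disjoint_family_on_def
  proof (intro ballI impI)
    fix k l :: nat assume "k \<noteq> l"
    then consider "k < l" | "l < k" by linarith
    then show "?E k \<inter> ?E l = {}" by cases (auto simp: not_le[symmetric])
  qed
  have "(\<Sum>k<K. (survival k - real K * s) * (Fbar (y + w) * (1 - s))) \<le> (\<Sum>k<K. prob (?E k))"
  proof (rule sum_mono)
    fix k assume "k \<in> {..<K}"
    then show "(survival k - real K * s) * (Fbar (y + w) * (1 - s)) \<le> prob (?E k)"
      using elim(1) Ft s(2) by (intro prob_jump_scenario_ge) (auto simp: w_def n_def)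
  qed
  also have "\<dots> = prob (\<Union>k<K. ?E k)"
    using Em by (intro finite_measure_finite_Union[symmetric] disj image_subsetI finite_lessThan)
  \<comment> \<open>The inclusion holds only almost surely, since \<open>area_gt\<close> needs a
    path that returns.\<close>
  also have "\<dots> \<le> prob ?A"
  proof (rule finite_measure_mono_AE)
    show "AE \<omega> in M. \<omega> \<in> (\<Union>k<K. ?E k) \<longrightarrow> \<omega> \<in> ?A"
      using AE_not_alive
    proof eventually_elim
      case (elim \<omega>)
      then obtain m where m: "\<not> alive m \<omega>" by blast
      show ?case
      proof
        assume "\<omega> \<in> (\<Union>k<K. ?E k)"
        then obtain k where "\<omega> \<in> ?E k" by blast
        then show "\<omega> \<in> ?A" using area_gt[OF \<open>0 < y\<close> w m, of k] unfolding n_def by blast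
      qed
    qed
  qed measurable
  finally have main: "(\<Sum>k<K. (survival k - real K * s) * (Fbar (y + w) * (1 - s))) \<le> prob ?A" .
  have "(\<Sum>k<K. (survival k - real K * s) * (Fbar (y + w) * (1 - s)))
      = ((\<Sum>k<K. survival k) - real K * (real K * s)) * (Fbar (y + w) * (1 - s))"
    by (simp add: sum_distrib_right[symmetric] sum_subtractf)
  also have "\<dots> \<ge> ((\<Sum>k<K. survival k) - real K * (real K * s)) * (((1 - s) * exp (- s) * G y) * (1 - s))"
    using elim(2) s by (intro mult_left_mono[OF _ pos] mult_right_mono) (auto simp: w_def)
  finally show ?case using main by (simp add: mult_ac)
qed

lemma area_lower:
  assumes \<epsilon>: "\<epsilon> > 0"
  shows "eventually (\<lambda>y. (suminf survival - \<epsilon>) * G y \<le> prob {\<omega> \<in> space M. rw_area X \<omega> > y\<^sup>2 / (2 * a)}) at_top"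
proof -
  have lim: "(\<lambda>K. \<Sum>k<K. survival k) \<longlonglongrightarrow> suminf survival" by (rule summable_LIMSEQ[OF summable_survival])
  have "eventually (\<lambda>K. suminf survival - \<epsilon> < (\<Sum>k<K. survival k) \<and> 1 \<le> K) sequentially"
    using order_tendstoD(1)[OF lim, of "suminf survival - \<epsilon>"] \<epsilon> by (intro eventually_conj eventually_ge_at_top) auto
  then obtain K where K: "suminf survival - \<epsilon> < (\<Sum>k<K. survival k)" "1 \<le> K"
    using eventually_happens'[OF sequentially_bot] by blast
  define P where "P = (\<Sum>k<K. survival k)"
  \<comment> \<open>This term makes \<open>P\<close> positive, so that
    \<open>P - K * (K * s)\<close> is nonnegative for small \<open>s\<close>, as the explicit bound
    requires.\<close>
  have "survival 0 = 1" by (simp add: survival_def alive_def prob_space)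
  moreover have "survival 0 \<le> P" unfolding P_def using K by (intro member_le_sum) (auto simp: survival_nonneg)
  ultimately have P: "P > 0" by simp
  \<comment> \<open>\<open>K\<close> is fixed before \<open>s\<close>, so the loss
    \<open>K * (K * s)\<close> vanishes as \<open>s\<close> tends to zero.\<close>
  let ?B = "\<lambda>s. (P - real K * (real K * s)) * ((1 - s) * exp (- s) * (1 - s))"
  have "(?B \<longlongrightarrow> (P - real K * (real K * 0)) * ((1 - 0) * exp (- 0) * (1 - 0))) (at_right 0)"
    by (intro tendsto_intros)
  from order_tendstoD(1)[OF this, of "suminf survival - \<epsilon>"]
  have 1: "eventually (\<lambda>s. suminf survival - \<epsilon> < ?B s) (at_right 0)" using K by (simp add: P_def)
  have "((\<lambda>s. P - real K * (real K * s)) \<longlongrightarrow> P - real K * (real K * 0)) (at_right 0)"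
    by (intro tendsto_intros)
  from order_tendstoD(1)[OF this, of 0]
  have 2: "eventually (\<lambda>s. 0 < P - real K * (real K * s)) (at_right 0)" using P by simp
  have "eventually (\<lambda>s::real. s \<in> {0<..<1}) (at_right 0)"
    by (rule eventually_at_right_real) simp
  with 1 2 have "eventually (\<lambda>s. suminf survival - \<epsilon> < ?B s \<and> 0 < P - real K * (real K * s) \<and> s \<in> {0<..<1}) (at_right 0)"
    by (intro eventually_conj)
  then have "\<exists>s. suminf survival - \<epsilon> < ?B s \<and> 0 < P - real K * (real K * s) \<and> s \<in> {0<..<1}"
    by (rule eventually_happens'[rotated]) (rule trivial_limit_at_right_real)
  then obtain s where s: "suminf survival - \<epsilon> < ?B s" "0 < P - real K * (real K * s)" "0 < s" "s < 1"
    unfolding greaterThanLessThan_iff by blast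
  show ?thesis
    using area_lower_explicit[OF s(3,4) less_imp_le[OF s(2)[unfolded P_def]]]
  proof eventually_elim
    case (elim y)
    have "(suminf survival - \<epsilon>) * G y \<le> ?B s * G y" using s(1) by (intro mult_right_mono G_nonneg less_imp_le)
    then show ?case using elim unfolding P_def by (rule order_trans)
  qed
qed

subsection \<open>The asymptotics\<close>

text \<open>The tail-sum formula, taken in the extended nonnegative reals so that finiteness comes
  from summability. The events \<open>t < rw_tau X \<omega>\<close> and
  \<open>alive t \<omega>\<close> agree off the null set of paths that never return.\<close>

lemma expectation_rw_tau: "expectation (\<lambda>\<omega>. real (rw_tau X \<omega>)) = suminf survival"
proof -
  have "(\<integral>\<^sup>+\<omega>. ennreal (real (rw_tau X \<omega>)) \<partial>M) = (\<integral>\<^sup>+\<omega>. of_nat (rw_tau X \<omega>) \<partial>M)"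
    by (simp add: ennreal_of_nat_eq_real_of_nat)
  also have "\<dots> = (\<Sum>t. emeasure M {\<omega> \<in> space M. t < rw_tau X \<omega>})"
    by (rule nn_integral_nat_function) measurable
  also have "\<dots> = (\<Sum>t. ennreal (survival t))"
  proof (rule arg_cong[where f=suminf], rule ext)
    fix t
    have "emeasure M {\<omega> \<in> space M. t < rw_tau X \<omega>} = emeasure M {\<omega> \<in> space M. alive t \<omega>}"
    proof (rule emeasure_eq_AE)
      show "AE \<omega> in M. \<omega> \<in> {\<omega> \<in> space M. t < rw_tau X \<omega>} \<longleftrightarrow> \<omega> \<in> {\<omega> \<in> space M. alive t \<omega>}"
        using AE_not_alive by eventually_elim (use rw_tau_le(2) in auto)
    qed measurable
    then show "emeasure M {\<omega> \<in> space M. t < rw_tau X \<omega>} = ennreal (survival t)"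
      by (simp add: survival_def emeasure_eq_measure)
  qed
  also have "\<dots> = ennreal (suminf survival)"
    by (intro suminf_ennreal2 survival_nonneg summable_survival)
  finally have "(\<integral>\<^sup>+\<omega>. ennreal (real (rw_tau X \<omega>)) \<partial>M) = ennreal (suminf survival)" .
  moreover have "0 \<le> suminf survival" by (intro suminf_nonneg summable_survival survival_nonneg)
  ultimately show ?thesis by (subst integral_eq_nn_integral) auto
qed

lemma area_G_lim: "((\<lambda>y. prob {\<omega> \<in> space M. rw_area X \<omega> > y\<^sup>2 / (2 * a)} / G y) \<longlongrightarrow> suminf survival) at_top"
proof (rule order_tendstoI)
  fix c assume c: "c < suminf survival"
  define \<epsilon> where "\<epsilon> = (suminf survival - c) / 2"
  have \<epsilon>: "\<epsilon> > 0" "c < suminf survival - \<epsilon>" using c by (auto simp: \<epsilon>_def field_simps)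
  show "eventually (\<lambda>y. c < prob {\<omega> \<in> space M. rw_area X \<omega> > y\<^sup>2 / (2 * a)} / G y) at_top"
    using area_lower[OF \<epsilon>(1)] eventually_gt_at_top[of 0]
  proof eventually_elim
    case (elim y)
    then have "suminf survival - \<epsilon> \<le> prob {\<omega> \<in> space M. rw_area X \<omega> > y\<^sup>2 / (2 * a)} / G y"
      using G_pos[of y] by (simp add: pos_le_divide_eq)
    then show ?case using \<epsilon> by linarith
  qed
next
  fix c assume c: "suminf survival < c"
  define \<epsilon> where "\<epsilon> = (c - suminf survival) / 2"
  have \<epsilon>: "\<epsilon> > 0" "suminf survival + \<epsilon> < c" using c by (auto simp: \<epsilon>_def field_simps)
  show "eventually (\<lambda>y. prob {\<omega> \<in> space M. rw_area X \<omega> > y\<^sup>2 / (2 * a)} / G y < c) at_top"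
    using area_upper[OF \<epsilon>(1)] eventually_gt_at_top[of 0]
  proof eventually_elim
    case (elim y)
    then have "prob {\<omega> \<in> space M. rw_area X \<omega> > y\<^sup>2 / (2 * a)} / G y \<le> suminf survival + \<epsilon>"
      using G_pos[of y] by (simp add: pos_divide_le_eq)
    then show ?case using \<epsilon> by linarith
  qed
qed

lemma area_asymp_equiv:
  "(\<lambda>x. prob {\<omega> \<in> space M. rw_area X \<omega> > x})
     \<sim>[at_top] (\<lambda>x. expectation (\<lambda>\<omega>. real (rw_tau X \<omega>)) * prob {\<omega> \<in> space M. X 0 \<omega> > sqrt (2 * a * x)})"
proof (rule asymp_equivI')
  let ?Q = "suminf survival"
  let ?y = "\<lambda>x. sqrt (2 * a * x)"
  have "survival 0 = 1" by (simp add: survival_def alive_def prob_space)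
  moreover have "sum survival {..<1} \<le> ?Q"
    by (intro sum_le_suminf summable_survival) (auto simp: survival_nonneg)
  ultimately have Q: "0 < ?Q" by simp
  have y: "filterlim ?y at_top at_top"
    using a_pos by (intro filterlim_compose[OF sqrt_at_top] filterlim_tendsto_pos_mult_at_top[OF tendsto_const])
      (auto simp: filterlim_ident)
  \<comment> \<open>Dividing numerator and denominator by \<open>G y\<close> reduces the claim to
    two known limits; positivity of \<open>?Q\<close> allows the quotient.\<close>
  have "((\<lambda>y. (prob {\<omega> \<in> space M. rw_area X \<omega> > y\<^sup>2 / (2 * a)} / G y) / (?Q * (Fbar y / G y))) \<longlongrightarrow> ?Q / (?Q * 1)) at_top"
    using Q by (intro tendsto_intros area_G_lim Fbar_G_lim) auto
  then have "((\<lambda>y. (prob {\<omega> \<in> space M. rw_area X \<omega> > y\<^sup>2 / (2 * a)} / G y) / (?Q * (Fbar y / G y))) \<longlongrightarrow> 1) at_top"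
    using Q by simp
  from filterlim_compose[OF this y]
  have "((\<lambda>x. (prob {\<omega> \<in> space M. rw_area X \<omega> > (?y x)\<^sup>2 / (2 * a)} / G (?y x)) / (?Q * (Fbar (?y x) / G (?y x)))) \<longlongrightarrow> 1) at_top" .
  moreover have "eventually (\<lambda>x. (prob {\<omega> \<in> space M. rw_area X \<omega> > (?y x)\<^sup>2 / (2 * a)} / G (?y x)) / (?Q * (Fbar (?y x) / G (?y x)))
     = prob {\<omega> \<in> space M. rw_area X \<omega> > x} / (expectation (\<lambda>\<omega>. real (rw_tau X \<omega>)) * prob {\<omega> \<in> space M. X 0 \<omega> > ?y x})) at_top"
    using eventually_gt_at_top[of 0]
  proof eventually_elim
    case (elim x)
    have "(?y x)\<^sup>2 / (2 * a) = x" using a_pos elim by simp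
    moreover have "G (?y x) \<noteq> 0" using G_pos[of "?y x"] a_pos elim by simp
    ultimately show ?case by (simp add: expectation_rw_tau Fbar_def)
  qed
  ultimately show "((\<lambda>x. prob {\<omega> \<in> space M. rw_area X \<omega> > x}
     / (expectation (\<lambda>\<omega>. real (rw_tau X \<omega>)) * prob {\<omega> \<in> space M. X 0 \<omega> > ?y x})) \<longlongrightarrow> 1) at_top"
    by (rule Lim_transform_eventually)
qed

end

theorem theorem2:
  fixes M :: "'a measure" and X :: "nat \<Rightarrow> 'a \<Rightarrow> real"
    and a \<gamma>0 :: real and g g' :: "real \<Rightarrow> real"
  assumes "prob_space M"
    and indep: "prob_space.indep_vars M (\<lambda>_. borel) X UNIV"
    and ident: "\<And>i. distr M borel (X i) = distr M borel (X 0)"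
    and a_pos: "a > 0"
    and integ: "integrable M (X 0)"
    and mean: "prob_space.expectation M (X 0) = - a"
    and var: "integrable M (\<lambda>\<omega>. (X 0 \<omega>)\<^sup>2)"
    and tail: "(\<lambda>x. measure M {\<omega> \<in> space M. X 0 \<omega> > x})
               \<sim>[at_top] (\<lambda>x. exp (- g x) * x powr (-2))"
    and g_deriv: "\<And>x. x > 0 \<Longrightarrow> (g has_real_derivative g' x) (at x)"
    and g'_cont: "continuous_on {0<..} g'"
    and g_mono: "\<exists>x0. \<forall>x y. x0 \<le> x \<longrightarrow> x \<le> y \<longrightarrow> g x \<le> g y"
    and \<gamma>0: "0 < \<gamma>0" "\<gamma>0 < 1/2"
    and g_ratio_antimono: "\<And>x y. 0 < x \<Longrightarrow> x \<le> y \<Longrightarrow> g y / y powr \<gamma>0 \<le> g x / x powr \<gamma>0"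
    and g_ratio_lim: "((\<lambda>x. g x / x powr \<gamma>0) \<longlongrightarrow> 0) at_top"
    and xg'_lim: "filterlim (\<lambda>x. x * g' x) at_top at_top"
  shows "(\<lambda>x. measure M {\<omega> \<in> space M. rw_area X \<omega> > x})
         \<sim>[at_top] (\<lambda>x. prob_space.expectation M (\<lambda>\<omega>. real (rw_tau X \<omega>))
                       * measure M {\<omega> \<in> space M. X 0 \<omega> > sqrt (2 * a * x)})"
proof -
  interpret prob_space M by fact
  interpret area_walk M X a \<gamma>0 g g'
    by (intro area_walk.intro area_walk_axioms.intro assms)
  show ?thesis by (rule area_asymp_equiv)
qed

end
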